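(* For every frequency $\lambda=(\lambda_n)$ the following statements are equivalent: (i) Bohr's theorem holds for $\lambda$. (ii) $\mathcal{D}_{\infty,+}(\lambda)$ is a Fréchet space. (iii) $\mathcal{D}_{\infty,+}(\lambda)$ is barrelled.
   Context: A frequency is a strictly increasing unbounded sequence $\lambda=(\lambda_n)_{n\ge 1}$ of non-negative real numbers. A $\lambda$-Dirichlet series is a formal series $D=\sum a_n e^{-\lambda_n s}$ with $a_n\in\mathbb{C}$ and $s$ a complex variable. Write $[\mathrm{Re}>\sigma]=\{s\in\mathbb{C}:\mathrm{Re}\,s>\sigma\}$. If $D$ converges at some point then it converges on some half-plane, where its limit function is holomorphic. Let $\sigma_u(D)=\inf\{\sigma\in\mathbb{R}: D \text{ converges uniformly on } [\mathrm{Re}>\sigma]\}$. Bohr's theorem holds for $\lambda$ if $\sigma_u(D)\le 0$ for every $D\in\mathcal{D}_\infty^{\mathrm{ext}}(\lambda)$, where $\mathcal{D}_\infty^{\mathrm{ext}}(\lambda)$ is the space of all $\lambda$-Dirichlet series that converge somewhere and whose limit function extends to a bounded holomorphic function on $[\mathrm{Re}>0]$. $\mathcal{D}_{\infty,+}(\lambda)$ is the space of all $\lambda$-Dirichlet series that converge on $[\mathrm{Re}>0]$ to a (necessarily holomorphic) function which is bounded on $[\mathrm{Re}>\sigma]$ for each $\sigma>0$, with the locally convex topology given by the norms $\|D\|_{k}=\sup_{\mathrm{Re}\,s>1/k}|D(s)|$, $k\in\mathbb{N}$. A pre-Fréchet space is a Hausdorff locally convex space whose topology is given by countably many seminorms;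 it is Fréchet if it is also complete. A locally convex space is barrelled if every barrel (absolutely convex, closed, absorbing set) is a zero-neighbourhood. *)

theory Defs
  imports "HOL-Analysis.Analysis" "HOL-Library.Function_Algebras"
begin

section \<open>Locally convex spaces\<close>

text \<open>
  A complex locally convex space is given by a complex scalar multiplication on a type, a linear
  subspace \<open>X\<close> of that type as carrier, and a topology \<open>T\<close> on \<open>X\<close> generated by seminorms.
\<close>

definition seminorm_on :: "(complex \<Rightarrow> 'a::ab_group_add \<Rightarrow> 'a) \<Rightarrow> 'a set \<Rightarrow> ('a \<Rightarrow> real) \<Rightarrow> bool" where
  "seminorm_on smul X p \<longleftrightarrow>
     (\<forall>x\<in>X. 0 \<le> p x) \<and>
     (\<forall>x\<in>X. \<forall>y\<in>X. p (x + y) \<le> p x + p y) \<and>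
     (\<forall>c. \<forall>x\<in>X. p (smul c x) = cmod c * p x)"

definition seminorm_topology :: "'a::ab_group_add set \<Rightarrow> ('a \<Rightarrow> real) set \<Rightarrow> 'a topology" where
  "seminorm_topology X P = topology (\<lambda>U. U \<subseteq> X \<and>
     (\<forall>x\<in>U. \<exists>F e. finite F \<and> F \<subseteq> P \<and> e > 0 \<and> (\<forall>y\<in>X. (\<forall>p\<in>F. p (y - x) < e) \<longrightarrow> y \<in> U)))"

lemma openin_seminorm_topology:
  "openin (seminorm_topology X P) U \<longleftrightarrow> U \<subseteq> X \<and>
     (\<forall>x\<in>U. \<exists>F e. finite F \<and> F \<subseteq> P \<and> e > 0 \<and> (\<forall>y\<in>X. (\<forall>p\<in>F. p (y - x) < e) \<longrightarrow> y \<in> U))"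
proof -
  let ?N = "\<lambda>U x F e. finite F \<and> F \<subseteq> P \<and> (0::real) < e \<and>
              (\<forall>y\<in>X. (\<forall>p\<in>F. p (y - x) < e) \<longrightarrow> y \<in> U)"
  let ?L = "\<lambda>U. U \<subseteq> X \<and> (\<forall>x\<in>U. \<exists>F e. ?N U x F e)"
  have "istopology ?L"
    unfolding istopology_def
  proof (intro conjI allI impI)
    fix S T assume S: "?L S" and T: "?L T"
    show "S \<inter> T \<subseteq> X" using S by blast
    show "\<forall>x\<in>S \<inter> T. \<exists>F e. ?N (S \<inter> T) x F e"
    proof
      fix x assume "x \<in> S \<inter> T"
      then have "\<exists>F e. ?N S x F e" "\<exists>F e. ?N T x F e"
        using S T by simp_all
      then obtain F e F' e' where F: "?N S x F e" and F': "?N T x F' e'"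
        by (elim exE) (rule that)
      have "?N (S \<inter> T) x (F \<union> F') (min e e')"
        using F F' by simp
      then show "\<exists>F e. ?N (S \<inter> T) x F e" by (intro exI)
    qed
  next
    fix K assume K: "\<forall>U\<in>K. ?L U"
    show "\<Union>K \<subseteq> X" using K by blast
    show "\<forall>x\<in>\<Union>K. \<exists>F e. ?N (\<Union>K) x F e"
    proof
      fix x assume "x \<in> \<Union>K"
      then obtain U where U: "U \<in> K" "x \<in> U" by blast
      then have "\<exists>F e. ?N U x F e" using K by simp
      then obtain F e where F: "?N U x F e" by (elim exE) (rule that)
      then have "?N (\<Union>K) x F e" using U by (simp, blast)
      then show "\<exists>F e. ?N (\<Union>K) x F e" by (intro exI)
    qed
  qed
  then show ?thesis
    unfolding seminorm_topology_def by (simp add: topology_inverse')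
qed

lemma topspace_seminorm_topology [simp]: "topspace (seminorm_topology X P) = X"
proof -
  have "openin (seminorm_topology X P) X"
    unfolding openin_seminorm_topology
  proof (intro conjI ballI subset_refl)
    fix x
    show "\<exists>F e. finite F \<and> F \<subseteq> P \<and> (0::real) < e \<and>
            (\<forall>y\<in>X. (\<forall>p\<in>F. p (y - x) < e) \<longrightarrow> y \<in> X)"
      by (rule exI[of _ "{}"], rule exI[of _ 1]) simp
  qed
  then show ?thesis
    by (meson openin_seminorm_topology openin_subset openin_topspace subset_antisym)
qed

definition locally_convex_space ::
    "(complex \<Rightarrow> 'a::ab_group_add \<Rightarrow> 'a) \<Rightarrow> 'a set \<Rightarrow> 'a topology \<Rightarrow> bool" where
  "locally_convex_space smul X T \<longleftrightarrow>
     vector_space smul \<and> module.subspace smul X \<and>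
     (\<exists>P. (\<forall>p\<in>P. seminorm_on smul X p) \<and> T = seminorm_topology X P)"

definition pre_frechet_space ::
    "(complex \<Rightarrow> 'a::ab_group_add \<Rightarrow> 'a) \<Rightarrow> 'a set \<Rightarrow> 'a topology \<Rightarrow> bool" where
  "pre_frechet_space smul X T \<longleftrightarrow>
     locally_convex_space smul X T \<and> Hausdorff_space T \<and>
     (\<exists>P. countable P \<and> (\<forall>p\<in>P. seminorm_on smul X p) \<and> T = seminorm_topology X P)"

text \<open>Completeness of the translation-invariant uniformity: every Cauchy filter converges.\<close>

definition cauchy_filter_in :: "'a::ab_group_add set \<Rightarrow> 'a topology \<Rightarrow> 'a filter \<Rightarrow> bool" where
  "cauchy_filter_in X T F \<longleftrightarrow>
     F \<noteq> bot \<and> (\<forall>\<^sub>F x in F. x \<in> X) \<and>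
     (\<forall>U. openin T U \<and> 0 \<in> U \<longrightarrow>
        (\<exists>S. (\<forall>\<^sub>F x in F. x \<in> S) \<and> (\<forall>x\<in>S. \<forall>y\<in>S. x - y \<in> U)))"

definition complete_tvs :: "'a::ab_group_add set \<Rightarrow> 'a topology \<Rightarrow> bool" where
  "complete_tvs X T \<longleftrightarrow>
     (\<forall>F. cauchy_filter_in X T F \<longrightarrow> (\<exists>x\<in>X. limitin T (\<lambda>y. y) x F))"

definition frechet_space ::
    "(complex \<Rightarrow> 'a::ab_group_add \<Rightarrow> 'a) \<Rightarrow> 'a set \<Rightarrow> 'a topology \<Rightarrow> bool" where
  "frechet_space smul X T \<longleftrightarrow> pre_frechet_space smul X T \<and> complete_tvs X T"

definition absolutely_convex :: "(complex \<Rightarrow> 'a::ab_group_add \<Rightarrow> 'a) \<Rightarrow> 'a set \<Rightarrow> bool" where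
  "absolutely_convex smul B \<longleftrightarrow>
     (\<forall>x\<in>B. \<forall>y\<in>B. \<forall>c d. cmod c + cmod d \<le> 1 \<longrightarrow> smul c x + smul d y \<in> B)"

definition absorbing :: "(complex \<Rightarrow> 'a::ab_group_add \<Rightarrow> 'a) \<Rightarrow> 'a set \<Rightarrow> 'a set \<Rightarrow> bool" where
  "absorbing smul X B \<longleftrightarrow> (\<forall>x\<in>X. \<exists>r>0. \<forall>c. cmod c \<le> r \<longrightarrow> smul c x \<in> B)"

definition barrel ::
    "(complex \<Rightarrow> 'a::ab_group_add \<Rightarrow> 'a) \<Rightarrow> 'a set \<Rightarrow> 'a topology \<Rightarrow> 'a set \<Rightarrow> bool" where
  "barrel smul X T B \<longleftrightarrow> absolutely_convex smul B \<and> closedin T B \<and> absorbing smul X B"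

definition barrelled_space ::
    "(complex \<Rightarrow> 'a::ab_group_add \<Rightarrow> 'a) \<Rightarrow> 'a set \<Rightarrow> 'a topology \<Rightarrow> bool" where
  "barrelled_space smul X T \<longleftrightarrow>
     locally_convex_space smul X T \<and>
     (\<forall>B. barrel smul X T B \<longrightarrow> (\<exists>U. openin T U \<and> 0 \<in> U \<and> U \<subseteq> B))"


section \<open>General Dirichlet series\<close>

text \<open>
  Sequences are indexed from \<open>0\<close>, so \<open>lam n\<close> and \<open>a n\<close> stand for \<open>\<lambda>\<^sub>n\<^sub>+\<^sub>1\<close> and \<open>a\<^sub>n\<^sub>+\<^sub>1\<close>.
  A formal \<open>\<lambda>\<close>-Dirichlet series is identified with its coefficient sequence.
\<close>

definition frequency :: "(nat \<Rightarrow> real) \<Rightarrow> bool" where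
  "frequency lam \<longleftrightarrow> strict_mono lam \<and> (\<forall>n. 0 \<le> lam n) \<and> \<not> bdd_above (range lam)"

definition half_plane :: "real \<Rightarrow> complex set" where
  "half_plane \<sigma> = {s. \<sigma> < Re s}"

definition dirichlet_term :: "(nat \<Rightarrow> real) \<Rightarrow> (nat \<Rightarrow> complex) \<Rightarrow> complex \<Rightarrow> nat \<Rightarrow> complex" where
  "dirichlet_term lam a s n = a n * exp (- (of_real (lam n) * s))"

definition dirichlet_converges :: "(nat \<Rightarrow> real) \<Rightarrow> (nat \<Rightarrow> complex) \<Rightarrow> complex \<Rightarrow> bool" where
  "dirichlet_converges lam a s \<longleftrightarrow> summable (dirichlet_term lam a s)"

definition dirichlet_limit :: "(nat \<Rightarrow> real) \<Rightarrow> (nat \<Rightarrow> complex) \<Rightarrow> complex \<Rightarrow> complex" where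
  "dirichlet_limit lam a s = (\<Sum>n. dirichlet_term lam a s n)"

definition sigma_u :: "(nat \<Rightarrow> real) \<Rightarrow> (nat \<Rightarrow> complex) \<Rightarrow> ereal" where
  "sigma_u lam a =
     Inf (ereal ` {\<sigma>. uniformly_convergent_on (half_plane \<sigma>)
                        (\<lambda>N s. \<Sum>n<N. dirichlet_term lam a s n)})"

text \<open>
  In \<open>D_inf_ext\<close>, the function \<open>g\<close> extends the limit function in the sense that it agrees with it on
  every half-plane of convergence inside \<open>[Re > 0]\<close>; a series that converges at one point \<open>s\<^sub>0\<close>
  converges on \<open>[Re > Re s\<^sub>0]\<close>, so there is such a half-plane.
\<close>

definition D_inf_ext :: "(nat \<Rightarrow> real) \<Rightarrow> (nat \<Rightarrow> complex) set" where
  "D_inf_ext lam = {a.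
     (\<exists>s. dirichlet_converges lam a s) \<and>
     (\<exists>g. g holomorphic_on half_plane 0 \<and> bounded (g ` half_plane 0) \<and>
        (\<forall>\<sigma>\<ge>0. (\<forall>s\<in>half_plane \<sigma>. dirichlet_converges lam a s) \<longrightarrow>
                 (\<forall>s\<in>half_plane \<sigma>. g s = dirichlet_limit lam a s)))}"

definition bohr_theorem_holds :: "(nat \<Rightarrow> real) \<Rightarrow> bool" where
  "bohr_theorem_holds lam \<longleftrightarrow> (\<forall>a\<in>D_inf_ext lam. sigma_u lam a \<le> 0)"

definition D_inf_plus :: "(nat \<Rightarrow> real) \<Rightarrow> (nat \<Rightarrow> complex) set" where
  "D_inf_plus lam = {a.
     (\<forall>s\<in>half_plane 0. dirichlet_converges lam a s) \<and>
     (\<forall>\<sigma>>0. bounded (dirichlet_limit lam a ` half_plane \<sigma>))}"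

definition coeff_scale :: "complex \<Rightarrow> (nat \<Rightarrow> complex) \<Rightarrow> (nat \<Rightarrow> complex)" where
  "coeff_scale c a = (\<lambda>n. c * a n)"

definition dirichlet_norm :: "(nat \<Rightarrow> real) \<Rightarrow> nat \<Rightarrow> (nat \<Rightarrow> complex) \<Rightarrow> real" where
  "dirichlet_norm lam k a = (SUP s\<in>half_plane (1 / real k). cmod (dirichlet_limit lam a s))"

text \<open>The index \<open>k = 0\<close> is excluded: \<open>1 / real 0 = 0\<close>, and \<open>D\<close> may be unbounded on \<open>[Re > 0]\<close>.\<close>

definition D_inf_plus_topology :: "(nat \<Rightarrow> real) \<Rightarrow> (nat \<Rightarrow> complex) topology" where
  "D_inf_plus_topology lam = seminorm_topology (D_inf_plus lam) (dirichlet_norm lam ` {1..})"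


subsection \<open>\<open>D_inf_plus lam\<close> is a locally convex space\<close>

lemma vector_space_coeff_scale: "vector_space coeff_scale"
  by unfold_locales (auto simp: coeff_scale_def fun_eq_iff algebra_simps)

lemma dirichlet_term_add:
  "dirichlet_term lam (a + b) s = (\<lambda>n. dirichlet_term lam a s n + dirichlet_term lam b s n)"
  by (auto simp: dirichlet_term_def algebra_simps)

lemma dirichlet_term_scale:
  "dirichlet_term lam (coeff_scale c a) s = (\<lambda>n. c * dirichlet_term lam a s n)"
  by (auto simp: dirichlet_term_def coeff_scale_def)

lemma dirichlet_limit_add:
  "dirichlet_converges lam a s \<Longrightarrow> dirichlet_converges lam b s \<Longrightarrow>
     dirichlet_limit lam (a + b) s = dirichlet_limit lam a s + dirichlet_limit lam b s"
  by (simp add: dirichlet_limit_def dirichlet_term_add dirichlet_converges_def suminf_add)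

lemma dirichlet_limit_scale:
  "dirichlet_converges lam a s \<Longrightarrow>
     dirichlet_limit lam (coeff_scale c a) s = c * dirichlet_limit lam a s"
  by (simp add: dirichlet_limit_def dirichlet_term_scale dirichlet_converges_def suminf_mult)

lemma D_inf_plus_converges:
  "a \<in> D_inf_plus lam \<Longrightarrow> 0 \<le> \<sigma> \<Longrightarrow> s \<in> half_plane \<sigma> \<Longrightarrow> dirichlet_converges lam a s"
  by (auto simp: D_inf_plus_def half_plane_def)

lemma subspace_D_inf_plus: "module.subspace coeff_scale (D_inf_plus lam)"
proof -
  interpret vector_space coeff_scale by (rule vector_space_coeff_scale)
  show ?thesis
  proof (rule subspaceI)
    have "dirichlet_term lam 0 s = (\<lambda>n. 0)" for s
      by (simp add: dirichlet_term_def fun_eq_iff)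
    then show "0 \<in> D_inf_plus lam"
      by (auto simp: D_inf_plus_def dirichlet_converges_def dirichlet_limit_def bounded_iff)
  next
    fix a b assume a: "a \<in> D_inf_plus lam" and b: "b \<in> D_inf_plus lam"
    have "bounded (dirichlet_limit lam (a + b) ` half_plane \<sigma>)" if "\<sigma> > 0" for \<sigma>
    proof -
      have "bounded ((\<lambda>s. dirichlet_limit lam a s + dirichlet_limit lam b s) ` half_plane \<sigma>)"
        using a b that by (intro bounded_plus_comp) (auto simp: D_inf_plus_def)
      moreover have "dirichlet_limit lam (a + b) s = dirichlet_limit lam a s + dirichlet_limit lam b s"
        if "s \<in> half_plane \<sigma>" for s
        using a b that \<open>\<sigma> > 0\<close> by (intro dirichlet_limit_add D_inf_plus_converges) auto
      ultimately show ?thesis by simp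
    qed
    moreover have "dirichlet_converges lam (a + b) s" if "s \<in> half_plane 0" for s
      using D_inf_plus_converges[OF a order.refl that] D_inf_plus_converges[OF b order.refl that]
      by (simp add: dirichlet_converges_def dirichlet_term_add summable_add)
    ultimately show "a + b \<in> D_inf_plus lam" by (simp add: D_inf_plus_def)
  next
    fix c a assume a: "a \<in> D_inf_plus lam"
    have "bounded (dirichlet_limit lam (coeff_scale c a) ` half_plane \<sigma>)" if "\<sigma> > 0" for \<sigma>
    proof -
      have "bounded ((\<lambda>z. c * z) ` dirichlet_limit lam a ` half_plane \<sigma>)"
        using a that
        by (intro bounded_linear_image[of "dirichlet_limit lam a ` half_plane \<sigma>"]
              bounded_linear_mult_right) (auto simp: D_inf_plus_def)
      moreover have "dirichlet_limit lam (coeff_scale c a) s = c * dirichlet_limit lam a s"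
        if "s \<in> half_plane \<sigma>" for s
        using a that \<open>\<sigma> > 0\<close> by (intro dirichlet_limit_scale D_inf_plus_converges) auto
      ultimately show ?thesis by (simp add: image_image)
    qed
    moreover have "dirichlet_converges lam (coeff_scale c a) s" if "s \<in> half_plane 0" for s
      using D_inf_plus_converges[OF a order.refl that]
      by (simp add: dirichlet_converges_def dirichlet_term_scale summable_mult)
    ultimately show "coeff_scale c a \<in> D_inf_plus lam" by (simp add: D_inf_plus_def)
  qed
qed

lemma half_plane_nonempty: "half_plane \<sigma> \<noteq> {}"
proof -
  have "of_real (\<sigma> + 1) \<in> half_plane \<sigma>" by (simp add: half_plane_def)
  then show ?thesis by blast
qed

lemma dirichlet_norm_bdd:
  assumes "a \<in> D_inf_plus lam" "k \<ge> 1"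
  shows "bdd_above ((\<lambda>s. cmod (dirichlet_limit lam a s)) ` half_plane (1 / real k))"
proof -
  have "bounded (dirichlet_limit lam a ` half_plane (1 / real k))"
    using assms by (simp add: D_inf_plus_def)
  then show ?thesis
    by (auto simp: bounded_iff bdd_above_def)
qed

lemma seminorm_on_dirichlet_norm:
  assumes "k \<ge> 1"
  shows "seminorm_on coeff_scale (D_inf_plus lam) (dirichlet_norm lam k)"
proof -
  let ?H = "half_plane (1 / real k)"
  let ?D = "dirichlet_limit lam"
  have upper: "cmod (?D a s) \<le> dirichlet_norm lam k a" if "a \<in> D_inf_plus lam" "s \<in> ?H" for a s
    unfolding dirichlet_norm_def using that dirichlet_norm_bdd[OF that(1) assms]
    by (intro cSUP_upper) auto
  have least: "dirichlet_norm lam k a \<le> M" if "\<And>s. s \<in> ?H \<Longrightarrow> cmod (?D a s) \<le> M" for a M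
    unfolding dirichlet_norm_def using that half_plane_nonempty by (intro cSUP_least) auto
  have conv: "dirichlet_converges lam a s" if "a \<in> D_inf_plus lam" "s \<in> ?H" for a s
    using that by (intro D_inf_plus_converges[of a lam "1 / real k"]) auto
  have nonneg: "0 \<le> dirichlet_norm lam k a" if "a \<in> D_inf_plus lam" for a
  proof -
    obtain s where "s \<in> ?H" using half_plane_nonempty by blast
    then show ?thesis using upper[OF that] norm_ge_zero order.trans by blast
  qed
  have add: "dirichlet_norm lam k (a + b) \<le> dirichlet_norm lam k a + dirichlet_norm lam k b"
    if "a \<in> D_inf_plus lam" "b \<in> D_inf_plus lam" for a b
  proof (rule least)
    fix s assume s: "s \<in> ?H"
    have "cmod (?D (a + b) s) \<le> cmod (?D a s) + cmod (?D b s)"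
      using that s by (simp add: dirichlet_limit_add conv norm_triangle_ineq)
    also have "\<dots> \<le> dirichlet_norm lam k a + dirichlet_norm lam k b"
      using upper that s by (intro add_mono) auto
    finally show "cmod (?D (a + b) s) \<le> dirichlet_norm lam k a + dirichlet_norm lam k b" .
  qed
  have le: "dirichlet_norm lam k (coeff_scale c a) \<le> cmod c * dirichlet_norm lam k a"
    if "a \<in> D_inf_plus lam" for c a
  proof (rule least)
    fix s assume s: "s \<in> ?H"
    show "cmod (?D (coeff_scale c a) s) \<le> cmod c * dirichlet_norm lam k a"
      using upper[OF that s]
      by (simp add: dirichlet_limit_scale conv[OF that s] norm_mult mult_left_mono)
  qed
  interpret vector_space coeff_scale by (rule vector_space_coeff_scale)
  have eq: "dirichlet_norm lam k (coeff_scale c a) = cmod c * dirichlet_norm lam k a"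
    if a: "a \<in> D_inf_plus lam" for c a
  proof (cases "c = 0")
    case True
    then show ?thesis
      using le[OF a, of c] nonneg[OF subspace_scale[OF subspace_D_inf_plus a], of c] by simp
  next
    case False
    have "dirichlet_norm lam k a = dirichlet_norm lam k (coeff_scale (inverse c) (coeff_scale c a))"
      using False by simp
    also have "\<dots> \<le> cmod (inverse c) * dirichlet_norm lam k (coeff_scale c a)"
      by (rule le[OF subspace_scale[OF subspace_D_inf_plus a]])
    finally have "cmod c * dirichlet_norm lam k a \<le> dirichlet_norm lam k (coeff_scale c a)"
      using False by (simp add: norm_inverse norm_divide divide_simps mult.commute)
    then show ?thesis using le[OF a, of c] by simp
  qed
  show ?thesis
    unfolding seminorm_on_def using nonneg add eq by blast
qed

lemma locally_convex_space_D_inf_plus: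
  "locally_convex_space coeff_scale (D_inf_plus lam) (D_inf_plus_topology lam)"
  unfolding locally_convex_space_def D_inf_plus_topology_def
  using vector_space_coeff_scale subspace_D_inf_plus seminorm_on_dirichlet_norm
  by (intro conjI exI[of _ "dirichlet_norm lam ` {1..}"]) auto

end

theory Submission
  imports Defs "HOL-Probability.Characteristic_Functions" "HOL-Complex_Analysis.Conformal_Mappings"
begin

text \<open>
  Write \<open>S\<^sub>N a\<close> for the partial sums of the series with coefficients \<open>a\<close>.  All three conditions amount to
  the same inequality: for every \<open>\<sigma> > 0\<close> the supremum of \<open>S\<^sub>N a\<close> over \<open>[Re > \<sigma>]\<close> is bounded, uniformly
  in \<open>N\<close>, by a constant times a supremum of the limit function over a larger half-plane.

  \<^bold>\<open>Barrelled implies Bohr.\<close>  A series in \<open>D_inf_plus\<close> converges at the point \<open>\<sigma>\<close>, so the set of all \<open>a\<close> with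
  \<open>\<bar>S\<^sub>N a (\<sigma>)\<bar> \<le> 1\<close> for all \<open>N\<close> absorbs; it is closed because coefficients depend continuously on the
  series.  It is thus a barrel, and if it is a neighbourhood of zero then \<open>S\<^sub>N a (\<sigma>)\<close> is bounded by some
  seminorm of \<open>a\<close>.  The seminorms decrease under translation into the half-plane, so the same bound
  holds at all points \<open>s\<close> with \<open>Re s \<ge> \<sigma>\<close>.  A series in \<open>D_inf_ext\<close> with extension \<open>g\<close> need not lie
  in \<open>D_inf_plus\<close>, but multiplying its coefficients by the Gaussian \<open>exp (- (\<epsilon> * lam n)\<^sup>2 / 2)\<close> makes it converge
  everywhere, with a limit that is a Gaussian average of \<open>g\<close> along vertical lines and so is bounded by
  the supremum of \<open>\<bar>g\<bar>\<close>.  The inequality for these smoothed series passes to the limit \<open>\<epsilon> \<rightarrow> 0\<close>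
  (\<open>gauss_smooth_bounded\<close>, \<open>barrelled_imp_bohr\<close>).

  \<^bold>\<open>Bohr implies Frechet.\<close>  If the inequality failed for Dirichlet polynomials at some \<open>\<sigma>\<close>, there
  would be polynomials bounded by one on \<open>[Re > 0]\<close> whose partial sums are at most one on \<open>[Re > \<sigma> + 1]\<close>
  but arbitrarily large on \<open>[Re > \<sigma>]\<close>: the failure has to come from partial sums of large index, and
  these are damped by \<open>exp (- lam n)\<close> when moving one unit to the right (\<open>polynomial_hump\<close>).  A
  gliding hump superposes such polynomials to a series that converges on \<open>[Re > \<sigma> + 1]\<close>, extends to a
  bounded function on \<open>[Re > 0]\<close>, and has unbounded partial sums on \<open>[Re > \<sigma>]\<close>, against Bohr's
  theorem.  The inequality extends from polynomials to \<open>D_inf_plus\<close>, where it makes the partial sums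
  of a Cauchy sequence converge uniformly in \<open>N\<close> and \<open>s\<close>; this gives completeness.

  \<^bold>\<open>Frechet implies barrelled\<close> is the usual Baire category argument.

  Coefficients are controlled throughout by \<open>dirichlet_term_le_vertical_bound\<close>: each term of a series is
  at most the supremum of the limit on a vertical line.  It is proved with Gaussian means, since the
  convergence on the line need not be uniform and only a growth \<open>O(\<bar>s\<bar>)\<close> of the partial sums is
  available there.
\<close>

section \<open>Frechet spaces are barrelled\<close>

lemma openin_seminorm_ball:
  assumes vs: "vector_space smul" and X: "module.subspace smul X"
    and p: "seminorm_on smul X p" "p \<in> P" and x0: "x0 \<in> X"
  shows "openin (seminorm_topology X P) {y \<in> X. p (y - x0) < e}"
  unfolding openin_seminorm_topology
proof (intro conjI ballI)
  interpret vector_space smul by (rule vs)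
  fix x assume x: "x \<in> {y \<in> X. p (y - x0) < e}"
  have "p (y - x0) < e" if "y \<in> X" "p (y - x) < e - p (x - x0)" for y
  proof -
    have "y - x \<in> X" "x - x0 \<in> X" using that x x0 subspace_diff[OF X] by auto
    then have "p ((y - x) + (x - x0)) \<le> p (y - x) + p (x - x0)"
      using p(1) unfolding seminorm_on_def by blast
    then show ?thesis using that by simp
  qed
  then show "\<exists>F e'. finite F \<and> F \<subseteq> P \<and> 0 < e' \<and> (\<forall>y\<in>X. (\<forall>p\<in>F. p (y - x) < e') \<longrightarrow> y \<in> {y \<in> X. p (y - x0) < e})"
    using x p(2) by (intro exI[of _ "{p}"] exI[of _ "e - p (x - x0)"]) auto
qed auto

lemma seminorm_diff_commute:
  assumes "vector_space smul" "module.subspace smul X" "seminorm_on smul X p" "x \<in> X" "y \<in> X"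
  shows "p (x - y) = p (y - x)"
proof -
  interpret vector_space smul by (rule assms(1))
  have "y - x \<in> X" using assms subspace_diff by blast
  then have "p (smul (- 1) (y - x)) = cmod (- 1) * p (y - x)"
    using assms(3) unfolding seminorm_on_def by blast
  then show ?thesis by simp
qed

lemma seminorm_triangle:
  assumes "vector_space smul" "module.subspace smul X" "seminorm_on smul X p" "x \<in> X" "y \<in> X" "z \<in> X"
  shows "p (x - z) \<le> p (x - y) + p (y - z)"
proof -
  interpret vector_space smul by (rule assms(1))
  have "x - y \<in> X" "y - z \<in> X" using assms subspace_diff by blast+
  then have "p ((x - y) + (y - z)) \<le> p (x - y) + p (y - z)"
    using assms(3) unfolding seminorm_on_def by blast
  then show ?thesis by simp
qed

text \<open>
  A barrel \<open>B\<close> that contains no neighbourhood of zero has multiples with empty interior.  Nested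
  neighbourhoods are chosen so that the one at stage \<open>j + 1\<close> misses \<open>(j + 1) B\<close>; their centres form a
  Cauchy sequence whose limit lies in no positive integer multiple of \<open>B\<close>, so \<open>B\<close> does not absorb it.
\<close>
lemma frechet_imp_barrelled:
  assumes frechet: "frechet_space smul X T"
  shows "barrelled_space smul X T"
  unfolding barrelled_space_def
proof (intro conjI allI impI)
  show "locally_convex_space smul X T"
    using frechet by (simp add: frechet_space_def pre_frechet_space_def)
  then have vs: "vector_space smul" and X: "module.subspace smul X" by (auto simp: locally_convex_space_def)
  interpret vector_space smul by (rule vs)
  obtain P where P': "countable P" "\<forall>p\<in>P. seminorm_on smul X p" and T: "T = seminorm_topology X P"
    using frechet unfolding frechet_space_def pre_frechet_space_def by (elim conjE exE)
  note P = P'(1) bspec[OF P'(2)]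
  have complete: "complete_tvs X T" using frechet by (simp add: frechet_space_def)
  have tri: "p (x - z) \<le> p (x - y) + p (y - z)" if "p \<in> P" "x \<in> X" "y \<in> X" "z \<in> X" for p x y z
    using seminorm_triangle[OF vs X P(2)] that by blast
  have comm: "p (x - y) = p (y - x)" if "p \<in> P" "x \<in> X" "y \<in> X" for p x y
    using seminorm_diff_commute[OF vs X P(2)] that by blast
  have hom: "p (smul c x) = cmod c * p x" if "p \<in> P" "x \<in> X" for p c x
    using P(2)[OF that(1)] that(2) unfolding seminorm_on_def by blast
  have zero: "p 0 = 0" if "p \<in> P" for p
    using hom[OF that subspace_0[OF X], of 0] by simp
  \<comment> \<open>finite sets increasing to \<open>P\<close>; intersecting with \<open>P\<close> discards the default values of \<open>from_nat_into\<close> if \<open>P\<close> is empty\<close>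
  define Q where "Q = (\<lambda>n. P \<inter> from_nat_into P ` {..<n})"
  have Q: "finite (Q n)" "Q n \<subseteq> P" for n by (auto simp: Q_def)
  have zeroQ: "p 0 = 0" if "p \<in> Q n" for p n using that Q(2) zero by blast
  have Q_mono: "Q n \<subseteq> Q m" if "n \<le> m" for n m using that by (auto simp: Q_def)
  have Q_cover: "\<exists>n. G \<subseteq> Q n" if "finite G" "G \<subseteq> P" for G
    using that
  proof (induction G)
    case (insert p G)
    then obtain n where n: "G \<subseteq> Q n" by blast
    obtain j where j: "from_nat_into P j = p" using from_nat_into_surj[OF P(1)] insert.prems by blast
    have "p \<in> Q (Suc j)" using insert.prems j by (auto simp: Q_def)
    then have "insert p G \<subseteq> Q (max n (Suc j))" using n Q_mono[of n "max n (Suc j)"] Q_mono[of "Suc j" "max n (Suc j)"] by auto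
    then show ?case by blast
  qed auto
  define V where "V = (\<lambda>x n r. {y \<in> X. \<forall>p\<in>Q n. p (y - x) < r})"
  have V_open: "openin T (V x n r)" if "x \<in> X" for x n r
  proof -
    have "openin T ((\<Inter>p\<in>Q n. {y \<in> X. p (y - x) < r}) \<inter> topspace T)"
      using Q that unfolding T by (intro openin_INT openin_seminorm_ball[OF vs X] P(2)) auto
    moreover have "(\<Inter>p\<in>Q n. {y \<in> X. p (y - x) < r}) \<inter> topspace T = V x n r"
      by (auto simp: V_def T)
    ultimately show ?thesis by simp
  qed
  have V_base: "\<exists>n r. r > 0 \<and> V x n r \<subseteq> U" if U: "openin T U" "x \<in> U" for U x
  proof -
    obtain G e where G: "finite G" "G \<subseteq> P" "e > 0" "\<And>y. y \<in> X \<Longrightarrow> \<forall>p\<in>G. p (y - x) < e \<Longrightarrow> y \<in> U"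
      using U unfolding T openin_seminorm_topology by meson
    obtain n where "G \<subseteq> Q n" using Q_cover[OF G(1,2)] by blast
    then have "V x n e \<subseteq> U" using G(4) by (auto simp: V_def)
    then show ?thesis using G(3) by blast
  qed
  fix B assume B: "barrel smul X T B"
  then have BX: "B \<subseteq> X" and closed: "openin T (X - B)"
    and absconv: "\<And>x y c d. x \<in> B \<Longrightarrow> y \<in> B \<Longrightarrow> cmod c + cmod d \<le> 1 \<Longrightarrow> smul c x + smul d y \<in> B"
    and absorb: "\<And>x. x \<in> X \<Longrightarrow> \<exists>r>0. \<forall>c. cmod c \<le> r \<longrightarrow> smul c x \<in> B"
    unfolding barrel_def closedin_def absolutely_convex_def absorbing_def by (auto simp: T)
  show "\<exists>U. openin T U \<and> 0 \<in> U \<and> U \<subseteq> B"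
  proof (rule ccontr)
    assume none: "\<not> ?thesis"
    have no_V: "\<not> V 0 n r \<subseteq> B" if "r > 0" for n r
    proof
      assume sub: "V 0 n r \<subseteq> B"
      have "0 \<in> V 0 n r" using that subspace_0[OF X] by (simp add: V_def zeroQ[of _ n])
      then show False using none V_open[OF subspace_0[OF X], of n r] sub by blast
    qed
    define R where "R = (\<lambda>(j::nat) (x, n, r) (x', n', r').
        Suc n \<le> n' \<and> r' \<le> r / 2 \<and> (\<forall>p\<in>Q n. p (x' - x) < r / 2) \<and>
        (\<forall>z\<in>V x' n' (2 * r'). smul (of_real (1 / real (Suc j))) z \<notin> B))"
    have "\<exists>f. \<forall>j. (case f j of (x, n::nat, r::real) \<Rightarrow> x \<in> X \<and> r > 0) \<and> R j (f j) (f (Suc j))"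
    proof (rule dependent_nat_choice)
      show "\<exists>st. case st of (x, n::nat, r::real) \<Rightarrow> x \<in> X \<and> r > 0"
        using subspace_0[OF X] by (intro exI[of _ "(0, 0, 1)"]) simp
    next
      fix st :: "'a \<times> nat \<times> real" and j
      assume st: "case st of (x, n, r) \<Rightarrow> x \<in> X \<and> r > 0"
      obtain x n r where st_eq: "st = (x, n, r)" by (cases st)
      have x: "x \<in> X" and r: "r > 0" using st by (auto simp: st_eq)
      define t where "t = real (Suc j)"
      have t: "t > 0" by (simp add: t_def)
      have "\<exists>y\<in>V x n (r / 2). smul (of_real (1 / t)) y \<notin> B"
      proof (rule ccontr)
        assume "\<not> ?thesis"
        then have all: "smul (of_real (1 / t)) y \<in> B" if "y \<in> V x n (r / 2)" for y using that by blast
        have "V 0 n (r / (2 * t)) \<subseteq> B"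
        proof
          fix v assume v: "v \<in> V 0 n (r / (2 * t))"
          then have vX: "v \<in> X" by (simp add: V_def)
          have small: "cmod c * p v < r / 2" if "p \<in> Q n" "cmod c = t" for p c
            using v that t by (auto simp: V_def field_simps)
          have inV: "x + smul c v \<in> V x n (r / 2)" if c: "cmod c = t" for c
            unfolding V_def
          proof (intro CollectI conjI ballI)
            show "x + smul c v \<in> X" by (intro subspace_add[OF X] subspace_scale[OF X] x vX)
            show "p (x + smul c v - x) < r / 2" if "p \<in> Q n" for p
            proof -
              have "p (smul c v) = cmod c * p v" using that Q(2) vX by (intro hom) auto
              then show ?thesis using small[OF that c] by simp
            qed
          qed
          \<comment> \<open>half the difference of the two points \<open>(x \<plusminus> t v) / t\<close> of \<open>B\<close> is \<open>v\<close>\<close>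
          have "smul (1 / 2) (smul (of_real (1 / t)) (x + smul (of_real t) v))
              + smul (- 1 / 2) (smul (of_real (1 / t)) (x + smul (of_real (- t)) v)) \<in> B"
            using t by (intro absconv all inV) auto
          moreover have "smul (1 / 2) (smul (of_real (1 / t)) (x + smul (of_real t) v))
              + smul (- 1 / 2) (smul (of_real (1 / t)) (x + smul (of_real (- t)) v)) = v"
          proof -
            have "smul (1 / 2) (smul (of_real (1 / t)) (x + smul (of_real t) v))
              + smul (- 1 / 2) (smul (of_real (1 / t)) (x + smul (of_real (- t)) v))
              = smul (1 / 2 * of_real (1 / t) + - 1 / 2 * of_real (1 / t)) x
              + smul (1 / 2 * of_real (1 / t) * of_real t + - 1 / 2 * of_real (1 / t) * of_real (- t)) v"
              by (simp only: scale_right_distrib scale_left_distrib scale_scale mult.assoc add.assoc add.left_commute add.commute)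
            also have "1 / 2 * complex_of_real (1 / t) + - 1 / 2 * of_real (1 / t) = 0" by simp
            also have "1 / 2 * of_real (1 / t) * complex_of_real t + - 1 / 2 * of_real (1 / t) * of_real (- t) = 1"
              using t by simp
            finally show ?thesis by simp
          qed
          ultimately show "v \<in> B" by simp
        qed
        then show False using no_V[of "r / (2 * t)" n] r t by simp
      qed
      then obtain y where y: "y \<in> V x n (r / 2)" "smul (of_real (1 / t)) y \<notin> B" by blast
      have yX: "y \<in> X" using y(1) by (simp add: V_def)
      have "smul (of_real (1 / t)) y \<in> X - B" using y(2) subspace_scale[OF X yX] by blast
      then obtain m \<rho> where \<rho>: "\<rho> > 0" "V (smul (of_real (1 / t)) y) m \<rho> \<subseteq> X - B"
        using V_base[OF closed] by blast
      define n' where "n' = max (Suc n) m"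
      \<comment> \<open>halved, since the limit of the centres is only known to lie within twice the radius\<close>
      define r' where "r' = min (r / 2) (t * \<rho> / 2)"
      have r': "r' > 0" "r' \<le> r / 2" "2 * r' \<le> t * \<rho>" using r t \<rho>(1) by (auto simp: r'_def min_def)
      have "smul (of_real (1 / t)) z \<notin> B" if z: "z \<in> V y n' (2 * r')" for z
      proof -
        have zX: "z \<in> X" using z by (simp add: V_def)
        have "smul (of_real (1 / t)) z \<in> V (smul (of_real (1 / t)) y) m \<rho>"
          unfolding V_def
        proof (intro CollectI conjI ballI)
          show "smul (of_real (1 / t)) z \<in> X" by (rule subspace_scale[OF X zX])
          fix p assume p: "p \<in> Q m"
          have "p \<in> Q n'" using p Q_mono[of m n'] by (auto simp: n'_def)
          then have "p (z - y) < 2 * r'" using z by (simp add: V_def)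
          then have "p (z - y) < t * \<rho>" using r'(3) by linarith
          moreover have "p (smul (of_real (1 / t)) (z - y)) = cmod (of_real (1 / t)) * p (z - y)"
            using p Q(2) subspace_diff[OF X zX yX] by (intro hom) auto
          ultimately show "p (smul (of_real (1 / t)) z - smul (of_real (1 / t)) y) < \<rho>"
            using t by (simp add: scale_right_diff_distrib[symmetric] norm_divide divide_less_eq mult.commute)
        qed
        then show ?thesis using \<rho>(2) by blast
      qed
      moreover have "\<forall>p\<in>Q n. p (y - x) < r / 2" using y(1) by (simp add: V_def)
      ultimately have "R j st (y, n', r')"
        using r' by (auto simp: R_def st_eq n'_def t_def)
      then show "\<exists>st'. (case st' of (x, n, r) \<Rightarrow> x \<in> X \<and> r > 0) \<and> R j st st'"
        using yX r' by (intro exI[of _ "(y, n', r')"]) simp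
    qed
    then obtain f where f: "\<forall>j. (case f j of (x, n::nat, r::real) \<Rightarrow> x \<in> X \<and> r > 0) \<and> R j (f j) (f (Suc j))"
      by (elim exE)
    define x where "x = (\<lambda>j. fst (f j))"
    define n where "n = (\<lambda>j. fst (snd (f j)))"
    define r where "r = (\<lambda>j. snd (snd (f j)))"
    have f_eq: "f j = (x j, n j, r j)" for j by (simp add: x_def n_def r_def)
    have x: "x j \<in> X" and r: "r j > 0" for j using spec[OF f, of j] by (auto simp: f_eq)
    have step: "Suc (n j) \<le> n (Suc j)" "r (Suc j) \<le> r j / 2" "\<And>p. p \<in> Q (n j) \<Longrightarrow> p (x (Suc j) - x j) < r j / 2"
      "\<And>z. z \<in> V (x (Suc j)) (n (Suc j)) (2 * r (Suc j)) \<Longrightarrow> smul (of_real (1 / real (Suc j))) z \<notin> B" for j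
      using spec[OF f, of j] unfolding f_eq R_def by auto
    have n_mono: "n j \<le> n m" if "j \<le> m" for j m
      using that step(1) by (induction m rule: dec_induct) (auto intro: order.trans Suc_leD)
    have n_ge: "j \<le> n j" for j
    proof (induction j)
      case (Suc j)
      then show ?case using step(1)[of j] by linarith
    qed simp
    have r_le: "r j \<le> r 0 * (1 / 2) ^ j" for j
    proof (induction j)
      case (Suc j)
      then show ?case using step(2)[of j] by simp
    qed simp
    have r_lim: "(\<lambda>j. r 0 * (1 / 2) ^ j) \<longlonglongrightarrow> 0"
      by (intro tendsto_mult_right_zero LIMSEQ_realpow_zero) auto
    \<comment> \<open>the slack \<open>r m\<close> pays for the steps after \<open>m\<close>\<close>
    have near: "p (x m - x j) \<le> r j - r m" if "j \<le> m" and p: "p \<in> Q (n j)" for j m p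
      using \<open>j \<le> m\<close>
    proof (induction m rule: dec_induct)
      case base
      then show ?case using zeroQ[OF p] by simp
    next
      case (step m)
      have "p \<in> Q (n m)" using p Q_mono[OF n_mono[OF step.hyps(1)]] by blast
      then have "p (x (Suc m) - x m) < r m / 2" by (rule \<open>\<And>j p. p \<in> Q (n j) \<Longrightarrow> p (x (Suc j) - x j) < r j / 2\<close>)
      moreover have "p (x (Suc m) - x j) \<le> p (x (Suc m) - x m) + p (x m - x j)"
        using p Q(2) x by (intro tri) auto
      moreover have "r (Suc m) \<le> r m / 2" by (rule \<open>\<And>j. r (Suc j) \<le> r j / 2\<close>)
      ultimately show ?case using step.IH by linarith
    qed
    have "cauchy_filter_in X T (filtermap x sequentially)"
      unfolding cauchy_filter_in_def
    proof (intro conjI allI impI)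
      show "filtermap x sequentially \<noteq> bot" by (simp add: filtermap_bot_iff)
      show "\<forall>\<^sub>F y in filtermap x sequentially. y \<in> X" using x by (simp add: eventually_filtermap)
      fix U assume U: "openin T U \<and> 0 \<in> U"
      obtain k e where e: "e > 0" "V 0 k e \<subseteq> U" using V_base[of U 0] U by blast
      have "\<forall>\<^sub>F j in sequentially. k \<le> j \<and> r 0 * (1 / 2) ^ j < e / 2"
        using e(1) by (intro eventually_conj eventually_ge_at_top order_tendstoD(2)[OF r_lim]) auto
      then obtain j where j: "k \<le> j" "r 0 * (1 / 2) ^ j < e / 2" unfolding eventually_sequentially by blast
      have "x a - x b \<in> U" if ab: "a \<ge> j" "b \<ge> j" for a b
      proof -
        have "p (x a - x b) < e" if "p \<in> Q k" for p
        proof -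
          have p: "p \<in> Q (n j)" using that Q_mono[of k "n j"] j(1) n_ge[of j] by auto
          then have "p \<in> P" using Q(2) by blast
          then have "p (x a - x b) \<le> p (x a - x j) + p (x b - x j)"
            using tri[of p "x a" "x j" "x b"] comm[of p "x b" "x j"] x by auto
          then show ?thesis
            using near[OF ab(1) p] near[OF ab(2) p] r[of a] r[of b] r_le[of j] j(2) by linarith
        qed
        then have "x a - x b \<in> V 0 k e" using subspace_diff[OF X x x] by (simp add: V_def)
        then show ?thesis using e(2) by blast
      qed
      then show "\<exists>S. (\<forall>\<^sub>F y in filtermap x sequentially. y \<in> S) \<and> (\<forall>y\<in>S. \<forall>z\<in>S. y - z \<in> U)"
        by (intro exI[of _ "x ` {j..}"]) (auto simp: eventually_filtermap eventually_sequentially)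
    qed
    then obtain l where l: "l \<in> X" "limitin T (\<lambda>y. y) l (filtermap x sequentially)"
      using complete unfolding complete_tvs_def by blast
    have l_near: "l \<in> V (x j) (n j) (2 * r j)" for j
      unfolding V_def
    proof (intro CollectI conjI ballI l(1))
      fix p assume p: "p \<in> Q (n j)"
      then have pP: "p \<in> P" using Q(2) by blast
      have "l \<in> V l (n j) (r j)" using l(1) r[of j] by (simp add: V_def zeroQ[of _ "n j"])
      then have "\<forall>\<^sub>F m in sequentially. x m \<in> V l (n j) (r j)"
        using l(2) V_open[OF l(1)] unfolding limitin_def eventually_filtermap by blast
      then have "\<forall>\<^sub>F m in sequentially. j \<le> m \<and> x m \<in> V l (n j) (r j)"
        by (intro eventually_conj eventually_ge_at_top)
      then obtain m where m: "j \<le> m" "x m \<in> V l (n j) (r j)" unfolding eventually_sequentially by blast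
      have "p (l - x j) \<le> p (x m - l) + p (x m - x j)"
        using tri[OF pP l(1) x[of m] x[of j]] comm[OF pP l(1) x[of m]] by simp
      moreover have "p (x m - l) < r j" using m(2) p by (simp add: V_def)
      ultimately show "p (l - x j) < 2 * r j" using near[OF m(1) p] r[of m] by linarith
    qed
    obtain \<rho> where \<rho>: "\<rho> > 0" "\<And>c. cmod c \<le> \<rho> \<Longrightarrow> smul c l \<in> B" using absorb[OF l(1)] by blast
    obtain j where "1 / real (Suc j) < \<rho>" using nat_approx_posE[OF \<rho>(1)] by blast
    then have "cmod (of_real (1 / real (Suc j))) \<le> \<rho>" unfolding norm_of_real by simp
    then have "smul (of_real (1 / real (Suc j))) l \<in> B" by (rule \<rho>(2))
    then show False using step(4)[OF l_near] by blast
  qed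
qed

section \<open>Summation by parts\<close>

text \<open>
  The complex weights \<open>w\<close> enter only through a real majorant \<open>v\<close> of their size and of their variation.
  This covers exponentials, decreasing real factors, and Gaussians alike.
\<close>
lemma summation_by_parts_bound:
  fixes c w :: "nat \<Rightarrow> complex" and v :: "nat \<Rightarrow> real"
  assumes sums: "\<And>M. norm (\<Sum>n=m..<M. c n) \<le> A"
    and var: "\<And>n. m \<le> n \<Longrightarrow> norm (w n - w (Suc n)) \<le> v n - v (Suc n)"
    and bound: "\<And>n. m \<le> n \<Longrightarrow> norm (w n) \<le> v n"
  shows "norm (\<Sum>n=m..<M. c n * w n) \<le> A * v m"
proof -
  let ?C = "\<lambda>M. \<Sum>n=m..<M. c n"
  have A: "0 \<le> A" using sums[of m] by simp
  have v: "0 \<le> v m" using bound[of m] norm_ge_zero[of "w m"] by linarith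
  show ?thesis
  proof (cases "m \<le> M")
    case True
    have parts: "(\<Sum>n=m..<M. c n * w n) = ?C M * w M + (\<Sum>n=m..<M. ?C (Suc n) * (w n - w (Suc n)))"
      using True by (induction M rule: dec_induct) (simp_all add: algebra_simps)
    have tele: "(\<Sum>n=m..<M. v n - v (Suc n)) = v m - v M"
      using True by (induction M rule: dec_induct) simp_all
    have "norm (\<Sum>n=m..<M. c n * w n)
        \<le> norm (?C M * w M) + (\<Sum>n=m..<M. norm (?C (Suc n) * (w n - w (Suc n))))"
      unfolding parts by (intro norm_triangle_le add_left_mono norm_sum)
    also have "\<dots> \<le> A * v M + (\<Sum>n=m..<M. A * (v n - v (Suc n)))"
      unfolding norm_mult
      by (intro add_mono sum_mono mult_mono sums bound var A True) auto
    also have "\<dots> = A * v m"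
      by (simp only: sum_distrib_left[symmetric] tele) (simp add: algebra_simps)
    finally show ?thesis .
  next
    case False
    then show ?thesis using A v by simp
  qed
qed

lemma norm_partial_block_le:
  fixes c :: "nat \<Rightarrow> complex"
  assumes "\<And>M. norm (\<Sum>n<M. c n) \<le> A"
  shows "norm (\<Sum>n=m..<M. c n) \<le> 2 * A"
proof (cases "m \<le> M")
  case True
  then have "(\<Sum>n=m..<M. c n) = (\<Sum>n<M. c n) - (\<Sum>n<m. c n)"
    by (simp add: sum_diff_nat_ivl lessThan_atLeast0)
  then show ?thesis
    using assms[of M] assms[of m] norm_triangle_ineq4[of "\<Sum>n<M. c n" "\<Sum>n<m. c n"] by simp
next
  case False
  then show ?thesis using assms[of 0] by simp
qed

lemma summable_by_parts:
  fixes c w :: "nat \<Rightarrow> complex" and v :: "nat \<Rightarrow> real"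
  assumes sums: "\<And>M. norm (\<Sum>n<M. c n) \<le> A"
    and var: "\<And>n. norm (w n - w (Suc n)) \<le> v n - v (Suc n)"
    and bound: "\<And>n. norm (w n) \<le> v n"
    and lim: "v \<longlonglongrightarrow> 0"
  shows "summable (\<lambda>n. c n * w n)"
  unfolding summable_Cauchy
proof (intro allI impI)
  fix e :: real assume "e > 0"
  have "(\<lambda>m. 2 * A * v m) \<longlonglongrightarrow> 2 * A * 0" by (intro tendsto_intros lim)
  then have "\<forall>\<^sub>F m in sequentially. 2 * A * v m < e"
    using \<open>e > 0\<close> by (intro order_tendstoD(2)[where a = e]) simp_all
  then obtain N where N: "\<And>m. m \<ge> N \<Longrightarrow> 2 * A * v m < e"
    unfolding eventually_sequentially by blast
  have "norm (\<Sum>n=m..<M. c n * w n) < e" if "m \<ge> N" for m M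
    using summation_by_parts_bound[of c m "2 * A" w v M, OF norm_partial_block_le[OF sums] var bound] N[OF that]
    by linarith
  then show "\<exists>N. \<forall>m\<ge>N. \<forall>n. norm (\<Sum>n=m..<n. c n * w n) < e" by blast
qed

lemma summable_bounded_partial_sums:
  fixes f :: "nat \<Rightarrow> complex"
  assumes "summable f"
  obtains A where "A \<ge> 0" "\<And>M. norm (\<Sum>n<M. f n) \<le> A"
proof -
  have "Bseq (\<lambda>M. \<Sum>n<M. f n)"
    using assms convergent_imp_Bseq by (auto simp: summable_iff_convergent)
  then obtain A where "A > 0" "\<forall>M. norm (\<Sum>n<M. f n) \<le> A" by (auto simp: Bseq_def)
  then show ?thesis using that[of A] by auto
qed

text \<open>
  The right-hand side is the integral over \<open>{\<alpha>..\<beta>}\<close> of the modulus of the derivative of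
  \<open>x \<mapsto> exp (- (x * z))\<close>.  It telescopes, as \<open>summation_by_parts_bound\<close> requires.
\<close>
lemma norm_exp_diff_le:
  fixes z :: complex and \<alpha> \<beta> :: real
  assumes "Re z > 0" "\<alpha> \<le> \<beta>"
  shows "norm (exp (- (of_real \<alpha> * z)) - exp (- (of_real \<beta> * z)))
           \<le> norm z / Re z * (exp (- (\<alpha> * Re z)) - exp (- (\<beta> * Re z)))"
proof (cases "\<alpha> = \<beta>")
  case False
  let ?f = "\<lambda>x::real. exp (- (of_real x * z))" and ?\<phi> = "\<lambda>x::real. - (norm z / Re z) * exp (- (x * Re z))"
  have "norm (?f \<beta> - ?f \<alpha>) \<le> ?\<phi> \<beta> - ?\<phi> \<alpha>"
  proof (rule differentiable_bound_general[where f' = "\<lambda>x. - z * ?f x" and \<phi>' = "\<lambda>x. norm z * exp (- (x * Re z))"])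
    show "\<alpha> < \<beta>" using False assms by simp
    show "continuous_on {\<alpha>..\<beta>} ?\<phi>" by (intro continuous_intros)
    show "continuous_on {\<alpha>..\<beta>} ?f" by (intro continuous_intros)
    show "(?f has_vector_derivative - z * ?f x) (at x)" for x
    proof -
      have "((\<lambda>y. exp (- (y * z))) has_field_derivative - z * ?f x) (at (of_real x))"
        by (auto intro!: derivative_eq_intros)
      then show ?thesis by (rule has_vector_derivative_real_field)
    qed
    show "(?\<phi> has_vector_derivative norm z * exp (- (x * Re z))) (at x)" for x
      unfolding has_real_derivative_iff_has_vector_derivative[symmetric]
      using assms by (auto intro!: derivative_eq_intros)
    show "norm (- z * ?f x) \<le> norm z * exp (- (x * Re z))" for x
      by (simp add: norm_mult)
  qed
  then show ?thesis by (simp add: norm_minus_commute algebra_simps)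
qed simp

section \<open>Dirichlet series in their half-plane of convergence\<close>

definition psum :: "(nat \<Rightarrow> real) \<Rightarrow> (nat \<Rightarrow> complex) \<Rightarrow> nat \<Rightarrow> complex \<Rightarrow> complex" where
  "psum lam a N s = (\<Sum>n<N. dirichlet_term lam a s n)"

lemma dirichlet_term_translate:
  "dirichlet_term lam a s n = dirichlet_term lam a w n * exp (- (of_real (lam n) * (s - w)))"
  by (simp add: dirichlet_term_def mult.assoc exp_add[symmetric] algebra_simps)

lemma frequency_mono: "frequency lam \<Longrightarrow> n \<le> m \<Longrightarrow> lam n \<le> lam m"
  by (simp add: frequency_def strict_mono_less_eq)

lemma frequency_nonneg: "frequency lam \<Longrightarrow> 0 \<le> lam n"
  by (simp add: frequency_def)

lemma frequency_at_top:
  assumes "frequency lam"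
  shows "filterlim lam at_top sequentially"
  unfolding filterlim_at_top eventually_sequentially
proof
  fix Z
  obtain N where "Z < lam N"
    using assms unfolding frequency_def bdd_above_def by (metis not_le rangeE)
  then show "\<exists>N. \<forall>n\<ge>N. Z \<le> lam n"
    using frequency_mono[OF assms] by (meson less_imp_le order.trans)
qed

lemma frequency_exp_tendsto_0:
  assumes "frequency lam" "\<delta> > 0"
  shows "(\<lambda>n. exp (- (lam n * \<delta>))) \<longlonglongrightarrow> 0"
proof -
  have "filterlim (\<lambda>n. - (lam n * \<delta>)) at_bot sequentially"
    using filterlim_tendsto_pos_mult_at_top[OF tendsto_const assms(2) frequency_at_top[OF assms(1)]]
    by (simp add: filterlim_uminus_at_top mult.commute)
  then show ?thesis using exp_at_bot filterlim_compose by blast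
qed

text \<open>
  Shifting from \<open>w\<close> to \<open>s\<close> multiplies the terms by \<open>exp (- (lam n * (s - w)))\<close>, and these weights have
  controlled variation.
\<close>
lemma dirichlet_block_bound:
  assumes "frequency lam" "\<And>M. norm (psum lam a M w) \<le> A" "Re s > Re w"
  shows "norm (\<Sum>n=m..<M. dirichlet_term lam a s n)
           \<le> 2 * A * (norm (s - w) / Re (s - w) * exp (- (lam m * Re (s - w))))"
  unfolding dirichlet_term_translate[of lam a s _ w]
proof (rule summation_by_parts_bound)
  show "norm (\<Sum>n=m..<M. dirichlet_term lam a w n) \<le> 2 * A" for M
    using assms(2) by (intro norm_partial_block_le) (simp add: psum_def)
next
  fix n
  show "norm (exp (- (of_real (lam n) * (s - w))) - exp (- (of_real (lam (Suc n)) * (s - w))))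
    \<le> norm (s - w) / Re (s - w) * exp (- (lam n * Re (s - w)))
      - norm (s - w) / Re (s - w) * exp (- (lam (Suc n) * Re (s - w)))"
    using norm_exp_diff_le[of "s - w" "lam n" "lam (Suc n)"] frequency_mono[OF assms(1), of n "Suc n"] assms(3)
    by (simp add: right_diff_distrib)
  have "1 \<le> norm (s - w) / Re (s - w)"
    using assms(3) complex_Re_le_cmod[of "s - w"] by simp
  then show "norm (exp (- (of_real (lam n) * (s - w)))) \<le> norm (s - w) / Re (s - w) * exp (- (lam n * Re (s - w)))"
    using mult_right_mono[of 1 "norm (s - w) / Re (s - w)" "exp (- (lam n * Re (s - w)))"] by simp
qed

text \<open>
  Convergence at one point costs at most linear growth along vertical lines; this is what makes
  Gaussian averages of the partial sums converge.
\<close>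
lemma psum_growth:
  assumes "frequency lam" "\<And>M. norm (psum lam a M w) \<le> A" "Re s > Re w"
  shows "norm (psum lam a N s) \<le> 2 * A * (norm (s - w) / Re (s - w))"
proof -
  have A: "0 \<le> A" using assms(2)[of 0] by (simp add: psum_def)
  have "norm (psum lam a N s) \<le> 2 * A * (norm (s - w) / Re (s - w) * exp (- (lam 0 * Re (s - w))))"
    using dirichlet_block_bound[OF assms, of 0 N] by (simp add: psum_def lessThan_atLeast0)
  also have "\<dots> \<le> 2 * A * (norm (s - w) / Re (s - w) * 1)"
    using A assms(3) frequency_nonneg[OF assms(1), of 0] by (intro mult_left_mono) auto
  finally show ?thesis by simp
qed

lemma dirichlet_converges_partial_bound:
  assumes "dirichlet_converges lam a w"
  obtains A where "A \<ge> 0" "\<And>M. norm (psum lam a M w) \<le> A"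
  using assms summable_bounded_partial_sums unfolding dirichlet_converges_def psum_def by blast

lemma psum_tendsto:
  "dirichlet_converges lam a s \<Longrightarrow> (\<lambda>N. psum lam a N s) \<longlonglongrightarrow> dirichlet_limit lam a s"
  unfolding dirichlet_converges_def psum_def dirichlet_limit_def by (rule summable_LIMSEQ)

lemma dirichlet_converges_if_psum_tendsto:
  assumes "(\<lambda>N. psum lam a N s) \<longlonglongrightarrow> L"
  shows "dirichlet_converges lam a s" "dirichlet_limit lam a s = L"
  using assms unfolding dirichlet_converges_def dirichlet_limit_def psum_def sums_def[symmetric]
  by (auto simp: sums_iff)

text \<open>
  The condition on \<open>S\<close> describes a Stolz angle with vertex \<open>w\<close>, away from the vertex.
\<close>
lemma uniform_limit_dirichlet:
  assumes fr: "frequency lam" and bound: "\<And>M. norm (psum lam a M w) \<le> A"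
    and S: "\<And>s. s \<in> S \<Longrightarrow> Re s \<ge> Re w + \<delta> \<and> norm (s - w) \<le> \<rho> * Re (s - w)" and \<delta>: "\<delta> > 0"
  shows "uniform_limit S (psum lam a) (dirichlet_limit lam a) sequentially"
proof -
  have A: "0 \<le> A" using bound[of 0] by (simp add: psum_def)
  have block: "norm (\<Sum>n=m..<M. dirichlet_term lam a s n) \<le> 2 * A * (\<bar>\<rho>\<bar> * exp (- (lam m * \<delta>)))"
    if s: "s \<in> S" for m M s
  proof -
    have "Re (s - w) > 0" using S[OF s] \<delta> by simp
    have "norm (s - w) / Re (s - w) \<le> \<bar>\<rho>\<bar>"
    proof -
      have "norm (s - w) \<le> \<rho> * Re (s - w)" using S[OF s] by simp
      also have "\<dots> \<le> \<bar>\<rho>\<bar> * Re (s - w)" using \<open>Re (s - w) > 0\<close> by (intro mult_right_mono) auto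
      finally show ?thesis using \<open>Re (s - w) > 0\<close> by (simp add: divide_le_eq)
    qed
    moreover have "exp (- (lam m * Re (s - w))) \<le> exp (- (lam m * \<delta>))"
      using S[OF s] frequency_nonneg[OF fr, of m] by (simp add: mult_left_mono)
    ultimately have "2 * A * (norm (s - w) / Re (s - w) * exp (- (lam m * Re (s - w))))
        \<le> 2 * A * (\<bar>\<rho>\<bar> * exp (- (lam m * \<delta>)))"
      using A by (intro mult_left_mono mult_mono) auto
    then show ?thesis
      using dirichlet_block_bound[OF fr bound, of s m M] S[OF s] \<delta> by linarith
  qed
  have lim: "(\<lambda>m. 2 * A * (\<bar>\<rho>\<bar> * exp (- (lam m * \<delta>)))) \<longlonglongrightarrow> 0"
    using frequency_exp_tendsto_0[OF fr \<delta>] by (intro tendsto_mult_right_zero)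
  have "uniformly_Cauchy_on S (psum lam a)"
  proof (rule uniformly_Cauchy_onI')
    fix e :: real assume "e > 0"
    then obtain K where K: "\<And>m. m \<ge> K \<Longrightarrow> 2 * A * (\<bar>\<rho>\<bar> * exp (- (lam m * \<delta>))) < e"
      using order_tendstoD(2)[OF lim] unfolding eventually_sequentially by blast
    have "dist (psum lam a m s) (psum lam a n s) < e" if "s \<in> S" "m \<ge> K" "n > m" for s m n
    proof -
      have "psum lam a n s - psum lam a m s = (\<Sum>i=m..<n. dirichlet_term lam a s i)"
        using that by (simp add: psum_def sum_diff_nat_ivl lessThan_atLeast0)
      then have "dist (psum lam a m s) (psum lam a n s) = norm (\<Sum>i=m..<n. dirichlet_term lam a s i)"
        by (metis dist_commute dist_norm)
      then show ?thesis using block[OF that(1), of m n] K[OF that(2)] by linarith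
    qed
    then show "\<exists>M. \<forall>s\<in>S. \<forall>m\<ge>M. \<forall>n>m. dist (psum lam a m s) (psum lam a n s) < e" by blast
  qed
  then obtain L where L: "uniform_limit S (psum lam a) L sequentially"
    using Cauchy_uniformly_convergent unfolding uniformly_convergent_on_def by blast
  have "L s = dirichlet_limit lam a s" if "s \<in> S" for s
    using dirichlet_converges_if_psum_tendsto(2)[OF tendsto_uniform_limitI[OF L that]] by simp
  then show ?thesis using L uniform_limit_cong'[of S "psum lam a" "psum lam a" L "dirichlet_limit lam a" sequentially] by simp
qed

lemma dirichlet_converges_half_plane:
  assumes "frequency lam" "dirichlet_converges lam a w" "Re s > Re w"
  shows "dirichlet_converges lam a s"
proof -
  obtain A where A: "\<And>M. norm (psum lam a M w) \<le> A"
    using dirichlet_converges_partial_bound[OF assms(2)] by blast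
  have "uniform_limit {s} (psum lam a) (dirichlet_limit lam a) sequentially"
    by (rule uniform_limit_dirichlet[OF assms(1) A, where \<delta> = "Re (s - w)" and \<rho> = "norm (s - w) / Re (s - w)"])
       (use assms(3) in auto)
  from tendsto_uniform_limitI[OF this] show ?thesis
    by (intro dirichlet_converges_if_psum_tendsto(1)) simp
qed

lemma open_half_plane: "open (half_plane \<sigma>)"
  unfolding half_plane_def by (simp add: open_halfspace_Re_gt)

lemma convex_half_plane: "convex (half_plane \<sigma>)"
  unfolding half_plane_def by (simp add: convex_halfspace_Re_gt)

lemma psum_holomorphic: "psum lam a N holomorphic_on S"
  unfolding psum_def[abs_def] dirichlet_term_def by (intro holomorphic_intros)

lemma dirichlet_limit_holomorphic:
  assumes fr: "frequency lam" and conv: "\<And>s. s \<in> half_plane \<sigma> \<Longrightarrow> dirichlet_converges lam a s"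
  shows "dirichlet_limit lam a holomorphic_on half_plane \<sigma>"
proof (rule holomorphic_uniform_sequence[OF open_half_plane psum_holomorphic])
  fix x assume x: "x \<in> half_plane \<sigma>"
  define \<delta> where "\<delta> = (Re x - \<sigma>) / 3"
  define w where "w = complex_of_real (\<sigma> + \<delta>)"
  have \<delta>: "\<delta> > 0" using x by (simp add: \<delta>_def half_plane_def)
  have "dirichlet_converges lam a w"
    using \<delta> by (intro conv) (simp add: w_def half_plane_def)
  then obtain A where A: "\<And>M. norm (psum lam a M w) \<le> A"
    using dirichlet_converges_partial_bound by blast
  have near: "Re y \<ge> Re x - \<delta>" "norm (y - w) \<le> \<delta> + norm (x - w)" if "y \<in> cball x \<delta>" for y
  proof -
    have "norm (x - y) \<le> \<delta>" using that by (simp add: dist_norm)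
    then show "Re y \<ge> Re x - \<delta>" using complex_Re_le_cmod[of "x - y"] by simp
    show "norm (y - w) \<le> \<delta> + norm (x - w)"
      using \<open>norm (x - y) \<le> \<delta>\<close> norm_triangle_ineq[of "y - x" "x - w"] by (simp add: norm_minus_commute)
  qed
  have x_eq: "Re x = \<sigma> + 3 * \<delta>" by (simp add: \<delta>_def field_simps)
  have "uniform_limit (cball x \<delta>) (psum lam a) (dirichlet_limit lam a) sequentially"
  proof (rule uniform_limit_dirichlet[OF fr A _ \<delta>, where \<rho> = "(\<delta> + norm (x - w)) / \<delta>"])
    fix y assume y: "y \<in> cball x \<delta>"
    have re: "Re (y - w) \<ge> \<delta>" using near(1)[OF y] x_eq by (simp add: w_def)
    have "norm (y - w) \<le> (\<delta> + norm (x - w)) / \<delta> * \<delta>" using near(2)[OF y] \<delta> by simp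
    also have "\<dots> \<le> (\<delta> + norm (x - w)) / \<delta> * Re (y - w)"
      using re \<delta> by (intro mult_left_mono) auto
    finally show "Re y \<ge> Re w + \<delta> \<and> norm (y - w) \<le> (\<delta> + norm (x - w)) / \<delta> * Re (y - w)"
      using re by simp
  qed
  moreover have "cball x \<delta> \<subseteq> half_plane \<sigma>"
  proof
    fix y assume "y \<in> cball x \<delta>"
    then show "y \<in> half_plane \<sigma>" using near(1)[of y] x_eq \<delta> by (simp add: half_plane_def)
  qed
  ultimately show "\<exists>d>0. cball x d \<subseteq> half_plane \<sigma> \<and>
      uniform_limit (cball x d) (psum lam a) (dirichlet_limit lam a) sequentially"
    using \<delta> by blast
qed

text \<open>
  For a purely real shift the weights are decreasing reals, so the bound does not grow with the
  imaginary part of \<open>s\<close>.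
\<close>
lemma dirichlet_block_decay:
  assumes fr: "frequency lam" and \<delta>: "\<delta> > 0" and bound: "\<And>N. norm (psum lam a N (s - of_real \<delta>)) \<le> A"
  shows "norm (\<Sum>n=m..<M. dirichlet_term lam a s n) \<le> 2 * A * exp (- (lam m * \<delta>))"
  unfolding dirichlet_term_translate[of lam a s _ "s - of_real \<delta>"]
proof (rule summation_by_parts_bound)
  show "norm (\<Sum>n=m..<M. dirichlet_term lam a (s - of_real \<delta>) n) \<le> 2 * A" for M
    using bound by (intro norm_partial_block_le) (simp add: psum_def)
  fix n
  have "lam n * \<delta> \<le> lam (Suc n) * \<delta>"
    using \<delta> frequency_mono[OF fr, of n "Suc n"] by (simp add: mult_right_mono)
  then have "norm (complex_of_real (exp (- (lam n * \<delta>)) - exp (- (lam (Suc n) * \<delta>))))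
    \<le> exp (- (lam n * \<delta>)) - exp (- (lam (Suc n) * \<delta>))"
    unfolding norm_of_real by simp
  then show "norm (exp (- (of_real (lam n) * (s - (s - of_real \<delta>)))) - exp (- (of_real (lam (Suc n)) * (s - (s - of_real \<delta>)))))
    \<le> exp (- (lam n * \<delta>)) - exp (- (lam (Suc n) * \<delta>))"
    by (simp add: exp_of_real[symmetric])
  show "norm (exp (- (of_real (lam n) * (s - (s - complex_of_real \<delta>))))) \<le> exp (- (lam n * \<delta>))"
    by simp
qed

lemma uniformly_convergent_if_psum_bounded:
  assumes fr: "frequency lam" and bound: "\<And>N s. Re s > \<sigma> \<Longrightarrow> norm (psum lam a N s) \<le> A" and \<delta>: "\<delta> > 0"
  shows "uniformly_convergent_on (half_plane (\<sigma> + \<delta>)) (psum lam a)"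
proof (rule Cauchy_uniformly_convergent, rule uniformly_Cauchy_onI')
  fix e :: real assume "e > 0"
  have lim: "(\<lambda>m. 2 * A * exp (- (lam m * \<delta>))) \<longlonglongrightarrow> 0"
    using frequency_exp_tendsto_0[OF fr \<delta>] by (intro tendsto_mult_right_zero)
  obtain K where K: "\<And>m. m \<ge> K \<Longrightarrow> 2 * A * exp (- (lam m * \<delta>)) < e"
    using order_tendstoD(2)[OF lim \<open>e > 0\<close>] unfolding eventually_sequentially by blast
  have "dist (psum lam a m s) (psum lam a n s) < e" if "s \<in> half_plane (\<sigma> + \<delta>)" "m \<ge> K" "n > m" for s m n
  proof -
    have "psum lam a n s - psum lam a m s = (\<Sum>i=m..<n. dirichlet_term lam a s i)"
      using that by (simp add: psum_def sum_diff_nat_ivl lessThan_atLeast0)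
    then have "dist (psum lam a m s) (psum lam a n s) = norm (\<Sum>i=m..<n. dirichlet_term lam a s i)"
      by (metis dist_commute dist_norm)
    also have "\<dots> \<le> 2 * A * exp (- (lam m * \<delta>))"
      using that(1) by (intro dirichlet_block_decay[OF fr \<delta>] bound) (simp add: half_plane_def)
    finally show ?thesis using K[OF that(2)] by linarith
  qed
  then show "\<exists>M. \<forall>s\<in>half_plane (\<sigma> + \<delta>). \<forall>m\<ge>M. \<forall>n>m. dist (psum lam a m s) (psum lam a n s) < e" by blast
qed

section \<open>Gaussian means\<close>

lemma prob_space_std_normal: "prob_space std_normal_distribution"
  using real_dist_normal_dist by (simp add: real_distribution_def)

lemma integral_std_normal_iexp:
  "(\<integral>t. exp (\<i> * of_real (x * t)) \<partial>std_normal_distribution) = of_real (exp (- x\<^sup>2 / 2))"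
  using fun_cong[OF char_std_normal_distribution, of x] by (simp add: char_def)

text \<open>
  If \<open>f\<close> is not integrable, its integral is zero by convention, and \<open>M\<close> is nonnegative.
\<close>
lemma norm_gaussian_mean_le:
  fixes f :: "real \<Rightarrow> complex"
  assumes "\<And>t. norm (f t) \<le> M"
  shows "norm (\<integral>t. f t \<partial>std_normal_distribution) \<le> M"
proof (cases "integrable std_normal_distribution f")
  case True
  interpret prob_space std_normal_distribution by (rule prob_space_std_normal)
  have "norm (\<integral>t. f t \<partial>std_normal_distribution) \<le> (\<integral>t. norm (f t) \<partial>std_normal_distribution)"
    by (rule integral_norm_bound)
  also have "\<dots> \<le> M" using True assms by (intro integral_le_const) auto
  finally show ?thesis .
next
  case False
  then show ?thesis
    using order.trans[OF norm_ge_zero assms[of 0]] by (simp add: not_integrable_integral_eq)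
qed

text \<open>
  Averaging a series along a vertical line against a Gaussian multiplies each term by a value of the
  Fourier transform of the Gaussian, which is again a Gaussian.  The interchange of sum and integral is
  dominated convergence, with the linear growth of the partial sums absorbed by the first moment.
\<close>
lemma dirichlet_gaussian_mean:
  assumes fr: "frequency lam" and conv: "dirichlet_converges lam a w" and s: "Re s > Re w"
  shows "(\<lambda>N. \<Sum>n<N. dirichlet_term lam a s n * of_real (exp (- (R * (lam n - \<xi>))\<^sup>2 / 2)))
    \<longlonglongrightarrow> (\<integral>t. dirichlet_limit lam a (s + \<i> * of_real (R * t)) * exp (\<i> * of_real (\<xi> * R * t)) \<partial>std_normal_distribution)"
proof -
  let ?N = std_normal_distribution
  interpret prob_space ?N by (rule prob_space_std_normal)
  obtain A where A: "A \<ge> 0" "\<And>M. norm (psum lam a M w) \<le> A"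
    using dirichlet_converges_partial_bound[OF conv] by blast
  let ?S = "\<lambda>N t. psum lam a N (s + \<i> * of_real (R * t)) * exp (\<i> * of_real (\<xi> * R * t))"
  let ?L = "\<lambda>t. dirichlet_limit lam a (s + \<i> * of_real (R * t)) * exp (\<i> * of_real (\<xi> * R * t))"
  let ?W = "\<lambda>t::real. 2 * A / Re (s - w) * (norm (s - w) + \<bar>R\<bar> * \<bar>t\<bar>)"
  have S_eq: "?S N t = (\<Sum>n<N. dirichlet_term lam a s n * exp (\<i> * of_real (- (R * (lam n - \<xi>)) * t)))" for N t
    unfolding psum_def sum_distrib_right
  proof (rule sum.cong)
    fix n
    have "- (of_real (lam n) * (s + \<i> * of_real (R * t))) + \<i> * of_real (\<xi> * R * t)
        = - (of_real (lam n) * s) + \<i> * of_real (- (R * (lam n - \<xi>)) * t)"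
      by (simp add: algebra_simps)
    then show "dirichlet_term lam a (s + \<i> * of_real (R * t)) n * exp (\<i> * of_real (\<xi> * R * t))
        = dirichlet_term lam a s n * exp (\<i> * of_real (- (R * (lam n - \<xi>)) * t))"
      unfolding dirichlet_term_def mult.assoc exp_add[symmetric] by simp
  qed simp
  have int_exp: "integrable ?N (\<lambda>t. exp (\<i> * of_real (x * t)))" for x
    by (intro integrable_const_bound[where B = 1]) (auto simp: norm_exp_i_times)
  have lim: "(\<lambda>N. ?S N t) \<longlonglongrightarrow> ?L t" for t
    by (intro tendsto_mult psum_tendsto tendsto_const dirichlet_converges_half_plane[OF fr conv]) (use s in simp)
  have S_meas: "?S N \<in> borel_measurable ?N" for N
    unfolding S_eq by measurable
  have "(\<lambda>N. \<integral>t. ?S N t \<partial>?N) \<longlonglongrightarrow> (\<integral>t. ?L t \<partial>?N)"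
  proof (rule integral_dominated_convergence[where w = ?W])
    show "?L \<in> borel_measurable ?N"
      by (rule borel_measurable_LIMSEQ_metric[OF S_meas lim])
    show "?S N \<in> borel_measurable ?N" for N by (rule S_meas)
    have "integrable ?N (\<lambda>t. \<bar>t\<bar>)"
      using integrable_std_normal_distribution_moment[of 1] by simp
    then show "integrable ?N ?W" by simp
    show "AE t in ?N. (\<lambda>N. ?S N t) \<longlonglongrightarrow> ?L t" using lim by simp
    show "AE t in ?N. norm (?S N t) \<le> ?W t" for N
    proof (rule AE_I2)
      fix t
      let ?z = "s + \<i> * of_real (R * t)"
      have "norm (?S N t) = norm (psum lam a N ?z)" by (simp add: norm_mult norm_exp_i_times)
      also have "\<dots> \<le> 2 * A * (norm (?z - w) / Re (?z - w))"
        using s by (intro psum_growth[OF fr A(2)]) simp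
      also have "\<dots> = 2 * A / Re (s - w) * norm (?z - w)" by simp
      also have "\<dots> \<le> ?W t"
        using norm_triangle_ineq[of "s - w" "\<i> * of_real (R * t)"] A s
        by (intro mult_left_mono) (auto simp: norm_mult abs_mult algebra_simps)
      finally show "norm (?S N t) \<le> ?W t" .
    qed
  qed
  moreover have "(\<integral>t. ?S N t \<partial>?N) = (\<Sum>n<N. dirichlet_term lam a s n * of_real (exp (- (R * (lam n - \<xi>))\<^sup>2 / 2)))" for N
    unfolding S_eq
    by (subst Bochner_Integration.integral_sum)
       (auto intro!: sum.cong int_exp integrable_mult_right simp only: integral_mult_right_zero integral_std_normal_iexp power2_minus)
  ultimately show ?thesis by simp
qed

text \<open>
  The mean at frequency \<open>lam n\<close> is at most \<open>M\<close> and equals the \<open>n\<close>-th term plus the other terms damped by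
  Gaussian factors.  As \<open>R\<close> grows, the finitely many terms before \<open>n\<close> vanish one by one, and the terms
  after \<open>n\<close> vanish together by summation by parts, since their factors decrease.
\<close>
lemma dirichlet_term_le_vertical_bound:
  assumes fr: "frequency lam" and conv: "dirichlet_converges lam a w" and s: "Re s > Re w"
    and M: "\<And>t. norm (dirichlet_limit lam a (s + \<i> * of_real t)) \<le> M"
  shows "norm (dirichlet_term lam a s n) \<le> M"
proof -
  let ?c = "dirichlet_term lam a s"
  let ?g = "\<lambda>R m. exp (- (R * (lam m - lam n))\<^sup>2 / 2)"
  obtain A where A: "A \<ge> 0" "\<And>M. norm (\<Sum>m<M. ?c m) \<le> A"
    using dirichlet_converges_partial_bound[OF dirichlet_converges_half_plane[OF fr conv s]]
    unfolding psum_def by blast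
  have mean: "norm (\<integral>t. dirichlet_limit lam a (s + \<i> * of_real (R * t)) * exp (\<i> * of_real (lam n * R * t)) \<partial>std_normal_distribution) \<le> M" for R
    by (rule norm_gaussian_mean_le) (simp only: norm_mult norm_exp_i_times M mult_1_right)
  have est: "norm (?c n) \<le> M + ((\<Sum>m<n. norm (?c m) * ?g R m) + 2 * A * ?g R (Suc n))" for R
  proof -
    let ?I = "\<integral>t. dirichlet_limit lam a (s + \<i> * of_real (R * t)) * exp (\<i> * of_real (lam n * R * t)) \<partial>std_normal_distribution"
    have part: "norm (?c n) \<le> norm (\<Sum>m<N. ?c m * of_real (?g R m)) + ((\<Sum>m<n. norm (?c m) * ?g R m) + 2 * A * ?g R (Suc n))"
      if N: "N \<ge> Suc n" for N
    proof -
      let ?X = "\<Sum>m<N. ?c m * of_real (?g R m)" and ?Y = "\<Sum>m<n. ?c m * of_real (?g R m)"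
        and ?Z = "\<Sum>m=Suc n..<N. ?c m * of_real (?g R m)"
      have "(\<Sum>m<N. ?c m * of_real (?g R m)) = (\<Sum>m<Suc n. ?c m * of_real (?g R m)) + ?Z"
        unfolding lessThan_atLeast0 by (rule sum.atLeastLessThan_concat[symmetric]) (use N in auto)
      then have "?c n = ?X - ?Y - ?Z" by simp
      then have "norm (?c n) \<le> norm ?X + norm ?Y + norm ?Z"
        using norm_triangle_ineq4[of "?X - ?Y" ?Z] norm_triangle_ineq4[of ?X ?Y] by (simp only:)
      moreover have "norm ?Y \<le> (\<Sum>m<n. norm (?c m) * ?g R m)"
        by (rule order.trans[OF norm_sum]) (simp add: norm_mult)
      moreover have "norm ?Z \<le> 2 * A * ?g R (Suc n)"
      proof (rule summation_by_parts_bound)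
        show "norm (\<Sum>m=Suc n..<M. ?c m) \<le> 2 * A" for M by (rule norm_partial_block_le[OF A(2)])
        fix m assume m: "Suc n \<le> m"
        have "0 \<le> lam m - lam n" "lam m - lam n \<le> lam (Suc m) - lam n"
          using m frequency_mono[OF fr] by auto
        then have "(R * (lam m - lam n))\<^sup>2 \<le> (R * (lam (Suc m) - lam n))\<^sup>2"
          by (simp add: power_mult_distrib mult_left_mono power_mono)
        then have "?g R (Suc m) \<le> ?g R m" by simp
        then show "norm (complex_of_real (?g R m) - of_real (?g R (Suc m))) \<le> ?g R m - ?g R (Suc m)"
          unfolding of_real_diff[symmetric] norm_of_real by linarith
        show "norm (complex_of_real (?g R m)) \<le> ?g R m" unfolding norm_of_real by simp
      qed
      ultimately show ?thesis by linarith
    qed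
    have "(\<lambda>N. norm (\<Sum>m<N. ?c m * of_real (?g R m)) + ((\<Sum>m<n. norm (?c m) * ?g R m) + 2 * A * ?g R (Suc n)))
      \<longlonglongrightarrow> norm ?I + ((\<Sum>m<n. norm (?c m) * ?g R m) + 2 * A * ?g R (Suc n))"
      by (intro tendsto_intros dirichlet_gaussian_mean[OF fr conv s])
    then have "norm (?c n) \<le> norm ?I + ((\<Sum>m<n. norm (?c m) * ?g R m) + 2 * A * ?g R (Suc n))"
      using part by (intro LIMSEQ_le_const) auto
    then show ?thesis using mean[of R] by linarith
  qed
  have g0: "(\<lambda>j. ?g (real j) m) \<longlonglongrightarrow> 0" if "lam m \<noteq> lam n" for m
  proof -
    have "(lam m - lam n)\<^sup>2 / 2 > 0" using that by simp
    moreover have "filterlim (\<lambda>j. (real j)\<^sup>2) at_top sequentially"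
      by (intro filterlim_pow_at_top filterlim_real_sequentially) simp
    ultimately have "filterlim (\<lambda>j. (lam m - lam n)\<^sup>2 / 2 * (real j)\<^sup>2) at_top sequentially"
      using filterlim_tendsto_pos_mult_at_top[OF tendsto_const] by blast
    then have "filterlim (\<lambda>j. - ((lam m - lam n)\<^sup>2 / 2 * (real j)\<^sup>2)) at_bot sequentially"
      by (simp add: filterlim_uminus_at_top)
    then have "(\<lambda>j. exp (- ((lam m - lam n)\<^sup>2 / 2 * (real j)\<^sup>2))) \<longlonglongrightarrow> 0"
      using exp_at_bot filterlim_compose by blast
    then show ?thesis by (simp add: power_mult_distrib mult.commute)
  qed
  have neq: "lam m \<noteq> lam n" if "m \<noteq> n" for m
    using fr that unfolding frequency_def by (simp add: strict_mono_eq)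
  have "(\<lambda>j. M + ((\<Sum>m<n. norm (?c m) * ?g (real j) m) + 2 * A * ?g (real j) (Suc n)))
      \<longlonglongrightarrow> M + ((\<Sum>m<n. norm (?c m) * 0) + 2 * A * 0)"
    by (intro tendsto_intros g0 neq) auto
  then show ?thesis
    using est by (intro LIMSEQ_le_const[where X = "\<lambda>j. M + ((\<Sum>m<n. norm (?c m) * ?g (real j) m) + 2 * A * ?g (real j) (Suc n))"]) auto
qed

text \<open>
  If \<open>lam\<close> grows slowly, the Gaussian factors are not summable; their use is that the smoothed series
  converges everywhere and that its limit is an average of the original limit over vertical lines.
\<close>
definition gauss_smooth :: "(nat \<Rightarrow> real) \<Rightarrow> real \<Rightarrow> (nat \<Rightarrow> complex) \<Rightarrow> nat \<Rightarrow> complex" where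
  "gauss_smooth lam \<epsilon> a = (\<lambda>n. a n * of_real (exp (- (\<epsilon> * lam n)\<^sup>2 / 2)))"

lemma dirichlet_term_gauss_smooth:
  "dirichlet_term lam (gauss_smooth lam \<epsilon> a) s n = dirichlet_term lam a s n * of_real (exp (- (\<epsilon> * lam n)\<^sup>2 / 2))"
  by (simp add: dirichlet_term_def gauss_smooth_def)

text \<open>
  The weight \<open>W x = exp (- (\<epsilon> * x)\<^sup>2 / 2 - x * (s - w))\<close> that leads from the series at \<open>w\<close> to the smoothed series at
  \<open>s\<close> satisfies \<open>\<bar>W x\<bar> \<le> C exp (- x)\<close> and \<open>\<bar>W' x\<bar> \<le> C exp (- x)\<close> even if \<open>s\<close> lies far to the left of \<open>w\<close>, so
  summation by parts applies with the majorant \<open>C exp (- lam n)\<close>.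
\<close>
lemma gauss_smooth_converges:
  assumes fr: "frequency lam" and conv: "dirichlet_converges lam a w" and \<epsilon>: "\<epsilon> > 0"
  shows "dirichlet_converges lam (gauss_smooth lam \<epsilon> a) s"
proof -
  define z where "z = s - w"
  define W where "W = (\<lambda>x::real. exp (- (of_real ((\<epsilon> * x)\<^sup>2 / 2) + of_real x * z)))"
  \<comment> \<open>\<open>\<epsilon>\<^sup>2 * x\<close> comes from the derivative of the Gaussian and is absorbed via \<open>y + 1 \<le> exp y\<close>; then complete the square\<close>
  define b where "b = norm z + 1 + \<epsilon>\<^sup>2"
  define C where "C = (norm z + 2) * exp (b\<^sup>2 / (2 * \<epsilon>\<^sup>2))"
  have W_norm: "norm (W x) \<le> exp (- ((\<epsilon> * x)\<^sup>2 / 2) + x * norm z)" if "x \<ge> 0" for x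
  proof -
    have "- (x * Re z) \<le> x * norm z"
      using that abs_Re_le_cmod[of z] mult_left_mono[of "- Re z" "norm z" x] by simp
    then show ?thesis by (simp add: W_def)
  qed
  have gauss: "(\<epsilon>\<^sup>2 * x + norm z + 1) * exp (- ((\<epsilon> * x)\<^sup>2 / 2) + x * norm z) \<le> C * exp (- x)" if x: "x \<ge> 0" for x
  proof -
    have e: "\<epsilon>\<^sup>2 * x + 1 \<le> exp (\<epsilon>\<^sup>2 * x)" "1 \<le> exp (\<epsilon>\<^sup>2 * x)"
      using exp_ge_add_one_self[of "\<epsilon>\<^sup>2 * x"] x by (linarith, simp)
    have "\<epsilon>\<^sup>2 * x + norm z + 1 \<le> exp (\<epsilon>\<^sup>2 * x) + norm z * exp (\<epsilon>\<^sup>2 * x)"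
      using e mult_left_mono[OF e(2), of "norm z"] by simp
    also have "\<dots> \<le> (norm z + 2) * exp (\<epsilon>\<^sup>2 * x)" by (simp add: algebra_simps)
    finally have 1: "\<epsilon>\<^sup>2 * x + norm z + 1 \<le> (norm z + 2) * exp (\<epsilon>\<^sup>2 * x)" .
    have "0 \<le> (\<epsilon> * x - b / \<epsilon>)\<^sup>2" by simp
    also have "\<dots> = (\<epsilon> * x)\<^sup>2 - 2 * (b * x) + b\<^sup>2 / \<epsilon>\<^sup>2"
      using \<epsilon> by (simp add: power2_diff power_divide)
    finally have 2: "\<epsilon>\<^sup>2 * x + (- ((\<epsilon> * x)\<^sup>2 / 2) + x * norm z) \<le> b\<^sup>2 / (2 * \<epsilon>\<^sup>2) + - x"
      by (simp add: b_def algebra_simps)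
    have "(\<epsilon>\<^sup>2 * x + norm z + 1) * exp (- ((\<epsilon> * x)\<^sup>2 / 2) + x * norm z)
      \<le> (norm z + 2) * exp (\<epsilon>\<^sup>2 * x) * exp (- ((\<epsilon> * x)\<^sup>2 / 2) + x * norm z)"
      using 1 by (intro mult_right_mono) auto
    also have "\<dots> = (norm z + 2) * exp (\<epsilon>\<^sup>2 * x + (- ((\<epsilon> * x)\<^sup>2 / 2) + x * norm z))"
      by (simp only: exp_add mult.assoc)
    also have "\<dots> \<le> (norm z + 2) * exp (b\<^sup>2 / (2 * \<epsilon>\<^sup>2) + - x)"
      using 2 by (intro mult_left_mono) auto
    also have "\<dots> = C * exp (- x)" by (simp only: C_def exp_add mult.assoc)
    finally show ?thesis .
  qed
  have W_bound: "norm (W x) \<le> C * exp (- x)" if "x \<ge> 0" for x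
  proof -
    have "1 * exp (- ((\<epsilon> * x)\<^sup>2 / 2) + x * norm z) \<le> (\<epsilon>\<^sup>2 * x + norm z + 1) * exp (- ((\<epsilon> * x)\<^sup>2 / 2) + x * norm z)"
      using that by (intro mult_right_mono) auto
    then show ?thesis using W_norm[OF that] gauss[OF that] by linarith
  qed
  have W_var: "norm (W y - W x) \<le> - C * exp (- y) - - C * exp (- x)" if "0 \<le> x" "x < y" for x y
  proof (rule differentiable_bound_general[OF that(2), where f' = "\<lambda>x. - (of_real (\<epsilon>\<^sup>2 * x) + z) * W x" and \<phi>' = "\<lambda>x. C * exp (- x)"])
    show "continuous_on {x..y} W" unfolding W_def by (intro continuous_intros) simp
    show "continuous_on {x..y} (\<lambda>x. - C * exp (- x))" by (intro continuous_intros)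
    show "(W has_vector_derivative - (of_real (\<epsilon>\<^sup>2 * u) + z) * W u) (at u)" for u
    proof -
      have "((\<lambda>x. exp (- ((of_real \<epsilon> * x)\<^sup>2 / 2 + x * z))) has_field_derivative - (of_real (\<epsilon>\<^sup>2 * u) + z) * W u) (at (of_real u))"
        by (auto intro!: derivative_eq_intros simp: W_def power2_eq_square algebra_simps)
      from has_vector_derivative_real_field[OF this] show ?thesis by (simp add: W_def)
    qed
    show "((\<lambda>x. - C * exp (- x)) has_vector_derivative C * exp (- u)) (at u)" for u
      unfolding has_real_derivative_iff_has_vector_derivative[symmetric]
      by (auto intro!: derivative_eq_intros)
    fix u assume "x < u"
    then have u: "u \<ge> 0" using that by simp
    have "norm (- (of_real (\<epsilon>\<^sup>2 * u) + z) * W u) \<le> (\<epsilon>\<^sup>2 * u + norm z) * norm (W u)"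
      unfolding norm_mult norm_minus_cancel
      by (intro mult_right_mono order.trans[OF norm_triangle_ineq]) (use u in \<open>auto simp: norm_mult norm_power\<close>)
    also have "\<dots> \<le> (\<epsilon>\<^sup>2 * u + norm z + 1) * exp (- ((\<epsilon> * u)\<^sup>2 / 2) + u * norm z)"
      using W_norm[OF u] u by (intro mult_mono) auto
    also have "\<dots> \<le> C * exp (- u)" by (rule gauss[OF u])
    finally show "norm (- (of_real (\<epsilon>\<^sup>2 * u) + z) * W u) \<le> C * exp (- u)" .
  qed
  obtain A where A: "\<And>M. norm (psum lam a M w) \<le> A"
    using dirichlet_converges_partial_bound[OF conv] by blast
  have "summable (\<lambda>n. dirichlet_term lam a w n * W (lam n))"
  proof (rule summable_by_parts)
    show "norm (\<Sum>n<M. dirichlet_term lam a w n) \<le> A" for M using A by (simp add: psum_def)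
    fix n
    have "lam n < lam (Suc n)" using fr by (simp add: frequency_def strict_mono_less)
    then show "norm (W (lam n) - W (lam (Suc n))) \<le> C * exp (- (lam n * 1)) - C * exp (- (lam (Suc n) * 1))"
      using W_var[OF frequency_nonneg[OF fr, of n], of "lam (Suc n)"] by (simp add: norm_minus_commute)
    show "norm (W (lam n)) \<le> C * exp (- (lam n * 1))" using W_bound[OF frequency_nonneg[OF fr]] by simp
  next
    show "(\<lambda>n. C * exp (- (lam n * 1))) \<longlonglongrightarrow> 0"
      using frequency_exp_tendsto_0[OF fr zero_less_one] by (rule tendsto_mult_right_zero)
  qed
  moreover have "dirichlet_term lam a w n * W (lam n) = dirichlet_term lam (gauss_smooth lam \<epsilon> a) s n" for n
  proof -
    have "W (lam n) = exp (- (of_real (lam n) * (s - w))) * of_real (exp (- (\<epsilon> * lam n)\<^sup>2 / 2))"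
      unfolding W_def z_def exp_of_real[symmetric] exp_add[symmetric] by (simp add: algebra_simps)
    then show ?thesis
      unfolding dirichlet_term_gauss_smooth dirichlet_term_translate[of lam a s n w] by simp
  qed
  ultimately show ?thesis by (simp add: dirichlet_converges_def)
qed

text \<open>
  Differentiation under the integral: by Cauchy's inequality a bounded holomorphic function is
  Lipschitz on every smaller half-plane, which dominates the difference quotients.
\<close>
lemma gaussian_mean_holomorphic:
  assumes hol: "f holomorphic_on half_plane 0" and bound: "\<And>s. s \<in> half_plane 0 \<Longrightarrow> norm (f s) \<le> M"
  shows "(\<lambda>s. \<integral>t. f (s + \<i> * of_real (\<epsilon> * t)) \<partial>std_normal_distribution) holomorphic_on half_plane 0"
    (is "?F holomorphic_on _")
proof -
  let ?N = std_normal_distribution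
  interpret prob_space ?N by (rule prob_space_std_normal)
  have "\<exists>f'. (?F has_field_derivative f') (at s0)" if s0: "s0 \<in> half_plane 0" for s0
  proof -
    define \<delta> where "\<delta> = Re s0 / 3"
    have \<delta>: "\<delta> > 0" "Re s0 = 3 * \<delta>" using s0 by (auto simp: \<delta>_def half_plane_def)
    have sub: "half_plane (2 * \<delta>) \<subseteq> half_plane 0" using \<delta> by (auto simp: half_plane_def)
    have deriv_f: "(f has_field_derivative deriv f z) (at z)" if "z \<in> half_plane 0" for z
      using holomorphic_derivI[OF hol open_half_plane that] .
    have deriv_bound: "norm (deriv f z) \<le> M / \<delta>" if z: "z \<in> half_plane (2 * \<delta>)" for z
    proof -
      have cb: "cball z \<delta> \<subseteq> half_plane 0"
      proof
        fix y assume "y \<in> cball z \<delta>"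
        then have "norm (z - y) \<le> \<delta>" by (simp add: dist_norm)
        then show "y \<in> half_plane 0"
          using complex_Re_le_cmod[of "z - y"] z \<delta>(1) by (simp add: half_plane_def)
      qed
      have "norm ((deriv ^^ 1) f z) \<le> fact 1 * M / \<delta> ^ 1"
      proof (rule Cauchy_inequality)
        show "f holomorphic_on ball z \<delta>"
          using hol cb ball_subset_cball holomorphic_on_subset by (metis order.trans)
        show "continuous_on (cball z \<delta>) f"
          using holomorphic_on_subset[OF hol cb] by (rule holomorphic_on_imp_continuous_on)
        show "norm (f x) \<le> M" if "norm (z - x) = \<delta>" for x
          using that cb by (intro bound) (auto simp: dist_norm)
      qed (rule \<delta>)
      then show ?thesis by simp
    qed
    have lip: "norm (f x - f y) \<le> M / \<delta> * norm (x - y)" if "x \<in> half_plane (2 * \<delta>)" "y \<in> half_plane (2 * \<delta>)" for x y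
      using that sub deriv_bound
      by (intro field_differentiable_bound[OF convex_half_plane, where f' = "deriv f"])
         (auto intro: has_field_derivative_at_within deriv_f)
    have cont: "continuous_on UNIV (\<lambda>t. f (s + \<i> * of_real (\<epsilon> * t)))" if "s \<in> half_plane 0" for s
      by (rule continuous_on_compose2[OF holomorphic_on_imp_continuous_on[OF hol]])
         (use that in \<open>auto simp: half_plane_def intro!: continuous_intros\<close>)
    have meas: "(\<lambda>t. f (s + \<i> * of_real (\<epsilon> * t))) \<in> borel_measurable ?N" if "s \<in> half_plane 0" for s
      using borel_measurable_continuous_onI[OF cont[OF that]] by simp
    have int: "integrable ?N (\<lambda>t. f (s + \<i> * of_real (\<epsilon> * t)))" if "s \<in> half_plane 0" for s
      by (rule integrable_const_bound[where B = M])
         (use that meas bound in \<open>auto simp: half_plane_def\<close>)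
    have ball_sub: "ball s0 \<delta> \<subseteq> half_plane (2 * \<delta>)"
    proof
      fix y assume "y \<in> ball s0 \<delta>"
      then have "norm (s0 - y) < \<delta>" by (simp add: dist_norm)
      then show "y \<in> half_plane (2 * \<delta>)"
        using complex_Re_le_cmod[of "s0 - y"] \<delta> by (simp add: half_plane_def)
    qed
    have "(?F has_field_derivative (\<integral>t. deriv f (s0 + \<i> * of_real (\<epsilon> * t)) \<partial>?N)) (at s0 within ball s0 \<delta>)"
      unfolding has_field_derivative_iff tendsto_at_iff_sequentially comp_def
    proof (intro allI impI)
      fix X assume X: "\<forall>i. X i \<in> ball s0 \<delta> - {s0}" and X_lim: "X \<longlonglongrightarrow> s0"
      let ?q = "\<lambda>i t. (f (X i + \<i> * of_real (\<epsilon> * t)) - f (s0 + \<i> * of_real (\<epsilon> * t))) / (X i - s0)"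
      have X0: "X i \<in> half_plane 0" "X i \<noteq> s0" for i using X ball_sub sub by blast+
      have q_meas: "?q i \<in> borel_measurable ?N" for i
        using meas[OF X0(1)[of i]] meas[OF s0] by (intro borel_measurable_divide borel_measurable_diff) auto
      have q_lim: "(\<lambda>i. ?q i t) \<longlonglongrightarrow> deriv f (s0 + \<i> * of_real (\<epsilon> * t))" for t
      proof -
        let ?u = "\<i> * complex_of_real (\<epsilon> * t)"
        have "((\<lambda>y. (f y - f (s0 + ?u)) / (y - (s0 + ?u))) \<longlongrightarrow> deriv f (s0 + ?u)) (at (s0 + ?u))"
          using deriv_f[of "s0 + ?u"] s0 by (simp add: has_field_derivative_iff half_plane_def)
        moreover have "filterlim (\<lambda>i. X i + ?u) (at (s0 + ?u)) sequentially"
          unfolding filterlim_at using X0(2) by (intro conjI tendsto_intros X_lim) auto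
        ultimately have "(\<lambda>i. (f (X i + ?u) - f (s0 + ?u)) / ((X i + ?u) - (s0 + ?u))) \<longlonglongrightarrow> deriv f (s0 + ?u)"
          by (rule filterlim_compose)
        then show ?thesis by simp
      qed
      have "(\<lambda>i. \<integral>t. ?q i t \<partial>?N) \<longlonglongrightarrow> (\<integral>t. deriv f (s0 + \<i> * of_real (\<epsilon> * t)) \<partial>?N)"
      proof (rule integral_dominated_convergence[where w = "\<lambda>t. M / \<delta>"])
        show "(\<lambda>t. deriv f (s0 + \<i> * of_real (\<epsilon> * t))) \<in> borel_measurable ?N"
          by (rule borel_measurable_LIMSEQ_metric[OF q_meas q_lim])
        show "AE t in ?N. norm (?q i t) \<le> M / \<delta>" for i
        proof (rule AE_I2)
          fix t
          have "X i + \<i> * of_real (\<epsilon> * t) \<in> half_plane (2 * \<delta>)" "s0 + \<i> * of_real (\<epsilon> * t) \<in> half_plane (2 * \<delta>)"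
            using X ball_sub \<delta> unfolding half_plane_def by (simp_all add: subset_iff)
          from lip[OF this] show "norm (?q i t) \<le> M / \<delta>"
            using X0(2)[of i] by (simp add: norm_divide divide_le_eq)
        qed
      qed (use q_meas q_lim in auto)
      moreover have "(\<integral>t. ?q i t \<partial>?N) = (?F (X i) - ?F s0) / (X i - s0)" for i
        using int[OF X0(1)] int[OF s0] by simp
      ultimately show "(\<lambda>i. (?F (X i) - ?F s0) / (X i - s0)) \<longlonglongrightarrow> (\<integral>t. deriv f (s0 + \<i> * of_real (\<epsilon> * t)) \<partial>?N)"
        by (simp only:)
    qed
    then show ?thesis using \<delta>(1) at_within_open[of s0 "ball s0 \<delta>"] by auto
  qed
  then show ?thesis
    using open_half_plane by (auto simp: holomorphic_on_open)
qed

text \<open>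
  Far to the right the limit of the smoothed series is the Gaussian mean of the limit, hence of \<open>f\<close>.
  Both are holomorphic on \<open>[Re > 0]\<close>, so they agree there, and a mean of \<open>f\<close> is bounded by \<open>M\<close>.
\<close>
lemma gauss_smooth_bounded:
  assumes fr: "frequency lam" and hol: "f holomorphic_on half_plane 0"
    and bound: "\<And>s. s \<in> half_plane 0 \<Longrightarrow> norm (f s) \<le> M"
    and conv: "dirichlet_converges lam a w"
    and eq: "\<And>s. s \<in> half_plane (max 0 (Re w)) \<Longrightarrow> f s = dirichlet_limit lam a s"
    and \<epsilon>: "\<epsilon> > 0" and s: "s \<in> half_plane 0"
  shows "norm (dirichlet_limit lam (gauss_smooth lam \<epsilon> a) s) \<le> M"
proof -
  let ?F = "\<lambda>s. \<integral>t. f (s + \<i> * of_real (\<epsilon> * t)) \<partial>std_normal_distribution"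
  have "dirichlet_limit lam (gauss_smooth lam \<epsilon> a) s = ?F s"
  proof (rule analytic_continuation_open[where s = "half_plane (max 0 (Re w))" and s' = "half_plane 0"
          and f = "dirichlet_limit lam (gauss_smooth lam \<epsilon> a)" and g = ?F])
    show "half_plane (max 0 (Re w)) \<noteq> {}" by (rule half_plane_nonempty)
    show "connected (half_plane 0)" by (rule convex_connected[OF convex_half_plane])
    show "half_plane (max 0 (Re w)) \<subseteq> half_plane 0" by (auto simp: half_plane_def)
    show "dirichlet_limit lam (gauss_smooth lam \<epsilon> a) holomorphic_on half_plane 0"
      by (intro dirichlet_limit_holomorphic fr gauss_smooth_converges[OF fr conv \<epsilon>])
    show "?F holomorphic_on half_plane 0" by (rule gaussian_mean_holomorphic[OF hol bound])
    fix z assume z: "z \<in> half_plane (max 0 (Re w))"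
    have "(\<lambda>N. psum lam (gauss_smooth lam \<epsilon> a) N z)
      \<longlonglongrightarrow> (\<integral>t. dirichlet_limit lam a (z + \<i> * of_real (\<epsilon> * t)) \<partial>std_normal_distribution)"
      using dirichlet_gaussian_mean[OF fr conv, of z \<epsilon> 0] z
      by (simp add: psum_def dirichlet_term_gauss_smooth half_plane_def)
    also have "(\<lambda>t. dirichlet_limit lam a (z + \<i> * of_real (\<epsilon> * t))) = (\<lambda>t. f (z + \<i> * of_real (\<epsilon> * t)))"
      using z by (intro ext eq[symmetric]) (simp add: half_plane_def)
    finally show "dirichlet_limit lam (gauss_smooth lam \<epsilon> a) z = ?F z"
      by (rule dirichlet_converges_if_psum_tendsto(2))
  qed (use open_half_plane s in auto)
  moreover have "norm (?F s) \<le> M"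
    by (rule norm_gaussian_mean_le) (use s in \<open>auto simp: half_plane_def intro!: bound\<close>)
  ultimately show ?thesis by simp
qed

section \<open>The seminorms of the space of Dirichlet series\<close>

lemma psum_diff: "psum lam (a - b) N s = psum lam a N s - psum lam b N s"
  by (simp add: psum_def dirichlet_term_def sum_subtractf algebra_simps)

lemma psum_add: "psum lam (a + b) N s = psum lam a N s + psum lam b N s"
  by (simp add: psum_def dirichlet_term_add sum.distrib)

lemma psum_scale: "psum lam (coeff_scale c a) N s = c * psum lam a N s"
  by (simp add: psum_def dirichlet_term_scale sum_distrib_left)

interpretation D: vector_space coeff_scale by (rule vector_space_coeff_scale)

lemmas D_inf_plus_diff = D.subspace_diff[OF subspace_D_inf_plus]

lemma dirichlet_limit_le_norm:
  assumes "a \<in> D_inf_plus lam" "k \<ge> 1" "s \<in> half_plane (1 / real k)"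
  shows "norm (dirichlet_limit lam a s) \<le> dirichlet_norm lam k a"
  unfolding dirichlet_norm_def using assms dirichlet_norm_bdd[OF assms(1,2)] by (intro cSUP_upper) auto

lemma dirichlet_norm_le:
  assumes "\<And>s. s \<in> half_plane (1 / real k) \<Longrightarrow> norm (dirichlet_limit lam a s) \<le> M"
  shows "dirichlet_norm lam k a \<le> M"
  unfolding dirichlet_norm_def using assms half_plane_nonempty by (intro cSUP_least) auto

lemma dirichlet_norm_mono:
  assumes a: "a \<in> D_inf_plus lam" and k: "1 \<le> k" "k \<le> m"
  shows "dirichlet_norm lam k a \<le> dirichlet_norm lam m a"
proof (rule dirichlet_norm_le)
  fix s assume s: "s \<in> half_plane (1 / real k)"
  have "1 / real m \<le> 1 / real k" using k by (simp add: frac_le)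
  then show "norm (dirichlet_limit lam a s) \<le> dirichlet_norm lam m a"
    using s k by (intro dirichlet_limit_le_norm a) (auto simp: half_plane_def)
qed

lemma dirichlet_term_le_norm:
  assumes fr: "frequency lam" and a: "a \<in> D_inf_plus lam" and k: "k \<ge> 1" and s: "Re s > 1 / real k"
  shows "norm (dirichlet_term lam a s n) \<le> dirichlet_norm lam k a"
proof (rule dirichlet_term_le_vertical_bound[OF fr, where w = "of_real (1 / real k)"])
  show "dirichlet_converges lam a (of_real (1 / real k))"
    using a k by (intro D_inf_plus_converges[where \<sigma> = 0]) (auto simp: half_plane_def)
  show "norm (dirichlet_limit lam a (s + \<i> * of_real t)) \<le> dirichlet_norm lam k a" for t
    using s by (intro dirichlet_limit_le_norm a k) (simp add: half_plane_def)
qed (use s in simp)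

lemma psum_le_norm:
  assumes "frequency lam" "a \<in> D_inf_plus lam" "k \<ge> 1" "Re s > 1 / real k"
  shows "norm (psum lam a N s) \<le> real N * dirichlet_norm lam k a"
proof -
  have "norm (psum lam a N s) \<le> (\<Sum>n<N. dirichlet_norm lam k a)"
    unfolding psum_def by (intro sum_norm_le dirichlet_term_le_norm assms)
  then show ?thesis by simp
qed

text \<open>
  The seminorms increase with \<open>k\<close>, so a single one suffices for a basic neighbourhood.
\<close>
lemma D_inf_plus_neighbourhood:
  assumes U: "openin (D_inf_plus_topology lam) U" "x \<in> U"
  obtains k e where "k \<ge> 1" "e > 0" "\<And>y. y \<in> D_inf_plus lam \<Longrightarrow> dirichlet_norm lam k (y - x) < e \<Longrightarrow> y \<in> U"
proof -
  have x: "x \<in> D_inf_plus lam"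
    using U openin_subset[OF U(1)] by (auto simp: D_inf_plus_topology_def)
  obtain F e where F: "finite F" "F \<subseteq> dirichlet_norm lam ` {1..}" "e > 0"
    and sub: "\<And>y. y \<in> D_inf_plus lam \<Longrightarrow> \<forall>p\<in>F. p (y - x) < e \<Longrightarrow> y \<in> U"
    using U unfolding D_inf_plus_topology_def openin_seminorm_topology by meson
  obtain K where K: "K \<subseteq> {1..}" "finite K" "F = dirichlet_norm lam ` K"
    using finite_subset_image[OF F(1,2)] by blast
  define k where "k = Max (insert 1 K)"
  have k: "j \<le> k" if "j \<in> insert 1 K" for j
    unfolding k_def using K(2) that by (intro Max_ge) auto
  show ?thesis
  proof (rule that[of k e])
    fix y assume y: "y \<in> D_inf_plus lam" "dirichlet_norm lam k (y - x) < e"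
    have "dirichlet_norm lam j (y - x) < e" if "j \<in> K" for j
      using dirichlet_norm_mono[OF D_inf_plus_diff[OF y(1) x], of j k] k[of j] K(1) that y(2) by force
    then show "y \<in> U" using sub[OF y(1)] K(3) by blast
  qed (use k[of 1] F(3) in auto)
qed

lemma openin_dirichlet_norm_ball:
  assumes "k \<ge> 1" "x0 \<in> D_inf_plus lam"
  shows "openin (D_inf_plus_topology lam) {y \<in> D_inf_plus lam. dirichlet_norm lam k (y - x0) < e}"
  unfolding D_inf_plus_topology_def
  using assms by (intro openin_seminorm_ball[OF vector_space_coeff_scale subspace_D_inf_plus seminorm_on_dirichlet_norm]) auto

text \<open>
  The terms of a series at \<open>w\<close> are the coefficients of its translate \<open>s \<mapsto> D (s + w)\<close>.
\<close>
definition dirichlet_shift :: "(nat \<Rightarrow> real) \<Rightarrow> complex \<Rightarrow> (nat \<Rightarrow> complex) \<Rightarrow> nat \<Rightarrow> complex" where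
  "dirichlet_shift lam w a = dirichlet_term lam a w"

lemma dirichlet_term_shift: "dirichlet_term lam (dirichlet_shift lam w a) s = dirichlet_term lam a (s + w)"
  by (simp add: fun_eq_iff dirichlet_shift_def dirichlet_term_def mult.assoc exp_add[symmetric] algebra_simps)

lemma psum_shift: "psum lam (dirichlet_shift lam w a) N s = psum lam a N (s + w)"
  by (simp add: psum_def dirichlet_term_shift)

lemma dirichlet_limit_shift: "dirichlet_limit lam (dirichlet_shift lam w a) s = dirichlet_limit lam a (s + w)"
  by (simp add: dirichlet_limit_def dirichlet_term_shift)

lemma dirichlet_converges_shift: "dirichlet_converges lam (dirichlet_shift lam w a) s = dirichlet_converges lam a (s + w)"
  by (simp add: dirichlet_converges_def dirichlet_term_shift)

lemma D_inf_plus_shift: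
  assumes "a \<in> D_inf_plus lam" "Re w \<ge> 0"
  shows "dirichlet_shift lam w a \<in> D_inf_plus lam"
  unfolding D_inf_plus_def
proof (intro CollectI conjI ballI allI impI)
  fix s assume "s \<in> half_plane 0"
  then show "dirichlet_converges lam (dirichlet_shift lam w a) s"
    using assms by (auto simp: dirichlet_converges_shift D_inf_plus_def half_plane_def)
next
  fix \<sigma> :: real assume "\<sigma> > 0"
  have "dirichlet_limit lam (dirichlet_shift lam w a) ` half_plane \<sigma> \<subseteq> dirichlet_limit lam a ` half_plane \<sigma>"
    using assms(2) by (auto simp: dirichlet_limit_shift half_plane_def intro!: imageI)
  then show "bounded (dirichlet_limit lam (dirichlet_shift lam w a) ` half_plane \<sigma>)"
    by (rule bounded_subset[rotated]) (use assms(1) \<open>\<sigma> > 0\<close> in \<open>simp add: D_inf_plus_def\<close>)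
qed

section \<open>Barrelledness implies Bohr's theorem\<close>

text \<open>
  The partial sums are tested at the single point \<open>\<sigma>\<close>: convergence there makes the set absorbing, while
  uniform boundedness on a half-plane is not available for a general series of the space.
\<close>
lemma barrel_bounded_partial_sums:
  assumes fr: "frequency lam" and \<sigma>: "\<sigma> > 0"
  defines "B \<equiv> {a \<in> D_inf_plus lam. \<forall>N. norm (psum lam a N (of_real \<sigma>)) \<le> 1}"
  shows "barrel coeff_scale (D_inf_plus lam) (D_inf_plus_topology lam) B"
  unfolding barrel_def
proof (intro conjI)
  show "absolutely_convex coeff_scale B"
    unfolding absolutely_convex_def
  proof (intro ballI allI impI)
    fix x y c d assume x: "x \<in> B" and y: "y \<in> B" and cd: "cmod c + cmod d \<le> 1"
    have "norm (psum lam (coeff_scale c x + coeff_scale d y) N (of_real \<sigma>)) \<le> 1" for N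
    proof -
      have "norm (psum lam (coeff_scale c x + coeff_scale d y) N (of_real \<sigma>))
          \<le> cmod c * norm (psum lam x N (of_real \<sigma>)) + cmod d * norm (psum lam y N (of_real \<sigma>))"
        unfolding psum_add psum_scale by (rule order.trans[OF norm_triangle_ineq]) (simp add: norm_mult)
      also have "\<dots> \<le> cmod c * 1 + cmod d * 1"
        using x y by (intro add_mono mult_left_mono) (auto simp: B_def)
      finally show ?thesis using cd by simp
    qed
    then show "coeff_scale c x + coeff_scale d y \<in> B"
      using x y unfolding B_def
      by (auto intro!: D.subspace_add D.subspace_scale subspace_D_inf_plus)
  qed
  show "closedin (D_inf_plus_topology lam) B"
    unfolding closedin_def
  proof (intro conjI)
    show "B \<subseteq> topspace (D_inf_plus_topology lam)" by (auto simp: B_def D_inf_plus_topology_def)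
    obtain k where k: "k \<ge> 1" "1 / real k < \<sigma>"
      using \<sigma> by (metis One_nat_def Suc_leI inverse_eq_divide nat_approx_posE zero_less_Suc)
    have "topspace (D_inf_plus_topology lam) - B
        = (\<Union>N. {a \<in> D_inf_plus lam. 1 < norm (psum lam a N (of_real \<sigma>))})"
      by (auto simp: B_def D_inf_plus_topology_def simp flip: not_le)
    moreover have "openin (D_inf_plus_topology lam) {a \<in> D_inf_plus lam. 1 < norm (psum lam a N (of_real \<sigma>))}" for N
      unfolding D_inf_plus_topology_def openin_seminorm_topology
    proof (intro conjI ballI)
      fix x assume x: "x \<in> {a \<in> D_inf_plus lam. 1 < norm (psum lam a N (of_real \<sigma>))}"
      let ?e = "(norm (psum lam x N (of_real \<sigma>)) - 1) / (real N + 1)"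
      have "1 < norm (psum lam y N (of_real \<sigma>))" if y: "y \<in> D_inf_plus lam" "dirichlet_norm lam k (y - x) < ?e" for y
      proof -
        have yx: "y - x \<in> D_inf_plus lam" using D_inf_plus_diff y(1) x by blast
        have "norm (psum lam (y - x) N (of_real \<sigma>)) \<le> real N * dirichlet_norm lam k (y - x)"
          using k by (intro psum_le_norm fr yx) auto
        also have "\<dots> \<le> real N * ?e" using y(2) by (intro mult_left_mono) auto
        also have "\<dots> < norm (psum lam x N (of_real \<sigma>)) - 1"
          using x by (simp add: divide_simps algebra_simps)
        finally have "norm (psum lam y N (of_real \<sigma>) - psum lam x N (of_real \<sigma>)) < norm (psum lam x N (of_real \<sigma>)) - 1"
          by (simp add: psum_diff)
        then show ?thesis
          using norm_triangle_ineq2[of "psum lam x N (of_real \<sigma>)" "psum lam y N (of_real \<sigma>)"]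
          by (simp add: norm_minus_commute)
      qed
      then show "\<exists>F e. finite F \<and> F \<subseteq> dirichlet_norm lam ` {1..} \<and> 0 < e \<and>
          (\<forall>y\<in>D_inf_plus lam. (\<forall>p\<in>F. p (y - x) < e) \<longrightarrow> y \<in> {a \<in> D_inf_plus lam. 1 < norm (psum lam a N (of_real \<sigma>))})"
        using x k by (intro exI[of _ "{dirichlet_norm lam k}"] exI[of _ ?e]) auto
    qed auto
    ultimately show "openin (D_inf_plus_topology lam) (topspace (D_inf_plus_topology lam) - B)"
      by auto
  qed
  show "absorbing coeff_scale (D_inf_plus lam) B"
    unfolding absorbing_def
  proof
    fix x assume x: "x \<in> D_inf_plus lam"
    have "dirichlet_converges lam x (of_real \<sigma>)"
      using \<sigma> by (intro D_inf_plus_converges[OF x, of 0]) (auto simp: half_plane_def)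
    then obtain A where A: "A \<ge> 0" "\<And>N. norm (psum lam x N (of_real \<sigma>)) \<le> A"
      using dirichlet_converges_partial_bound by blast
    have "coeff_scale c x \<in> B" if c: "cmod c \<le> 1 / (A + 1)" for c
    proof -
      have "cmod c * norm (psum lam x N (of_real \<sigma>)) \<le> 1 / (A + 1) * A" for N
        using A c by (intro mult_mono) auto
      also have "1 / (A + 1) * A \<le> 1" using A(1) by simp
      finally show ?thesis
        using x by (simp add: B_def psum_scale norm_mult D.subspace_scale[OF subspace_D_inf_plus])
    qed
    then show "\<exists>r>0. \<forall>c. cmod c \<le> r \<longrightarrow> coeff_scale c x \<in> B"
      using A(1) by (intro exI[of _ "1 / (A + 1)"]) auto
  qed
qed

text \<open>
  The bound at \<open>\<sigma>\<close> is applied to the translate of \<open>a\<close> by \<open>s - \<sigma>\<close>, which has no larger seminorms.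
\<close>
lemma barrelled_imp_partial_sum_bound:
  assumes fr: "frequency lam" and \<sigma>: "\<sigma> > 0"
    and bar: "barrelled_space coeff_scale (D_inf_plus lam) (D_inf_plus_topology lam)"
  obtains k C where "k \<ge> 1" "C > 0"
    "\<And>a M N s. a \<in> D_inf_plus lam \<Longrightarrow> M > 0 \<Longrightarrow>
       (\<And>z. z \<in> half_plane (1 / real k) \<Longrightarrow> norm (dirichlet_limit lam a z) \<le> M) \<Longrightarrow> Re s \<ge> \<sigma> \<Longrightarrow>
       norm (psum lam a N s) \<le> C * M"
proof -
  let ?B = "{a \<in> D_inf_plus lam. \<forall>N. norm (psum lam a N (of_real \<sigma>)) \<le> 1}"
  obtain U where U: "openin (D_inf_plus_topology lam) U" "0 \<in> U" "U \<subseteq> ?B"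
    using bar barrel_bounded_partial_sums[OF fr \<sigma>] unfolding barrelled_space_def by meson
  obtain k e where k: "k \<ge> 1" "e > 0" and nb: "\<And>y. y \<in> D_inf_plus lam \<Longrightarrow> dirichlet_norm lam k (y - 0) < e \<Longrightarrow> y \<in> U"
    using D_inf_plus_neighbourhood[OF U(1,2)] by blast
  show ?thesis
  proof (rule that[of k "2 / e"])
    fix a M N s
    assume a: "a \<in> D_inf_plus lam" and M: "M > 0" and s: "Re s \<ge> \<sigma>"
      and bound: "\<And>z. z \<in> half_plane (1 / real k) \<Longrightarrow> norm (dirichlet_limit lam a z) \<le> M"
    define w where "w = s - of_real \<sigma>"
    have w: "Re w \<ge> 0" using s by (simp add: w_def)
    define c where "c = complex_of_real (e / (2 * M))"
    have aw: "dirichlet_shift lam w a \<in> D_inf_plus lam" by (rule D_inf_plus_shift[OF a w])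
    then have y: "coeff_scale c (dirichlet_shift lam w a) \<in> D_inf_plus lam"
      by (rule D.subspace_scale[OF subspace_D_inf_plus])
    have "dirichlet_norm lam k (coeff_scale c (dirichlet_shift lam w a)) \<le> e / 2"
    proof (rule dirichlet_norm_le)
      fix z assume z: "z \<in> half_plane (1 / real k)"
      have "dirichlet_converges lam (dirichlet_shift lam w a) z"
        using z by (intro D_inf_plus_converges[OF aw _ z]) simp
      then have "norm (dirichlet_limit lam (coeff_scale c (dirichlet_shift lam w a)) z) = cmod c * norm (dirichlet_limit lam a (z + w))"
        by (simp add: dirichlet_limit_scale dirichlet_limit_shift norm_mult)
      also have "\<dots> \<le> cmod c * M"
        using z w by (intro mult_left_mono bound) (auto simp: half_plane_def)
      also have "\<dots> = e / 2" using M k by (simp add: c_def norm_divide norm_mult)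
      finally show "norm (dirichlet_limit lam (coeff_scale c (dirichlet_shift lam w a)) z) \<le> e / 2" .
    qed
    then have "coeff_scale c (dirichlet_shift lam w a) \<in> U" using nb[OF y] k by simp
    then have "norm (psum lam (coeff_scale c (dirichlet_shift lam w a)) N (of_real \<sigma>)) \<le> 1" using U(3) by blast
    then have "cmod c * norm (psum lam a N s) \<le> 1"
      by (simp add: psum_scale psum_shift norm_mult w_def)
    then show "norm (psum lam a N s) \<le> 2 / e * M"
      using M k by (simp add: c_def norm_divide norm_mult divide_simps mult.commute)
  qed (use k in auto)
qed

lemma gauss_smooth_in_D_inf_plus:
  assumes fr: "frequency lam" and conv: "dirichlet_converges lam a w" and \<epsilon>: "\<epsilon> > 0"
    and bound: "\<And>s. s \<in> half_plane 0 \<Longrightarrow> norm (dirichlet_limit lam (gauss_smooth lam \<epsilon> a) s) \<le> M"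
  shows "gauss_smooth lam \<epsilon> a \<in> D_inf_plus lam"
  unfolding D_inf_plus_def
proof (intro CollectI conjI ballI allI impI)
  show "dirichlet_converges lam (gauss_smooth lam \<epsilon> a) s" for s
    by (rule gauss_smooth_converges[OF fr conv \<epsilon>])
  fix \<sigma> :: real assume "\<sigma> > 0"
  then show "bounded (dirichlet_limit lam (gauss_smooth lam \<epsilon> a) ` half_plane \<sigma>)"
    using bound unfolding bounded_iff by (intro exI[of _ M]) (auto simp: half_plane_def)
qed

lemma D_inf_extE:
  assumes fr: "frequency lam" and a: "a \<in> D_inf_ext lam"
  obtains w g M where "dirichlet_converges lam a w" "g holomorphic_on half_plane 0" "M > 0"
    "\<And>s. s \<in> half_plane 0 \<Longrightarrow> norm (g s) \<le> M"
    "\<And>s. s \<in> half_plane (max 0 (Re w)) \<Longrightarrow> g s = dirichlet_limit lam a s"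
proof -
  obtain w g where w: "dirichlet_converges lam a w"
    and g: "g holomorphic_on half_plane 0" "bounded (g ` half_plane 0)"
      "\<And>\<sigma>. \<sigma> \<ge> 0 \<Longrightarrow> \<forall>s\<in>half_plane \<sigma>. dirichlet_converges lam a s \<Longrightarrow> \<forall>s\<in>half_plane \<sigma>. g s = dirichlet_limit lam a s"
    using a unfolding D_inf_ext_def by blast
  obtain M where M: "M > 0" "\<And>s. s \<in> half_plane 0 \<Longrightarrow> norm (g s) \<le> M"
    using g(2) unfolding bounded_pos by blast
  have "g s = dirichlet_limit lam a s" if "s \<in> half_plane (max 0 (Re w))" for s
    using g(3)[of "max 0 (Re w)"] dirichlet_converges_half_plane[OF fr w] that by (auto simp: half_plane_def)
  then show ?thesis using that w g(1) M by blast
qed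

lemma sigma_u_nonpos_if_uniform:
  assumes "\<And>\<sigma>. \<sigma> > 0 \<Longrightarrow> uniformly_convergent_on (half_plane \<sigma>) (psum lam a)"
  shows "sigma_u lam a \<le> 0"
proof (rule ccontr)
  assume "\<not> sigma_u lam a \<le> 0"
  then have "0 < sigma_u lam a" by simp
  then obtain r where r: "0 < ereal r" "ereal r < sigma_u lam a" using ereal_dense2 by blast
  have "uniformly_convergent_on (half_plane r) (\<lambda>N s. \<Sum>n<N. dirichlet_term lam a s n)"
    using assms[of r] r(1) by (simp add: psum_def[abs_def])
  then have "sigma_u lam a \<le> ereal r"
    unfolding sigma_u_def by (intro Inf_lower imageI) simp
  then show False using r(2) by simp
qed

text \<open>
  The inequality holds for the smoothed series with a bound independent of \<open>\<epsilon>\<close>, and each partial sum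
  depends continuously on \<open>\<epsilon>\<close>.  Bounded partial sums on a half-plane give uniform convergence on every
  smaller one.
\<close>
lemma barrelled_imp_bohr:
  assumes fr: "frequency lam"
    and bar: "barrelled_space coeff_scale (D_inf_plus lam) (D_inf_plus_topology lam)"
  shows "bohr_theorem_holds lam"
  unfolding bohr_theorem_holds_def
proof
  fix a assume a: "a \<in> D_inf_ext lam"
  obtain w g M where w: "dirichlet_converges lam a w" and g: "g holomorphic_on half_plane 0" and M: "M > 0"
    "\<And>s. s \<in> half_plane 0 \<Longrightarrow> norm (g s) \<le> M"
    and eq: "\<And>s. s \<in> half_plane (max 0 (Re w)) \<Longrightarrow> g s = dirichlet_limit lam a s"
    using D_inf_extE[OF fr a] by metis
  have smooth: "norm (dirichlet_limit lam (gauss_smooth lam \<epsilon> a) s) \<le> M" if "\<epsilon> > 0" "s \<in> half_plane 0" for \<epsilon> s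
    using gauss_smooth_bounded[OF fr g M(2) w eq that] .
  show "sigma_u lam a \<le> 0"
  proof (rule sigma_u_nonpos_if_uniform)
    fix \<sigma> :: real assume \<sigma>: "\<sigma> > 0"
    then have "\<sigma> / 2 > 0" by simp
    then obtain k C where k: "k \<ge> 1" "C > 0" and bound:
      "\<And>a M N s. a \<in> D_inf_plus lam \<Longrightarrow> M > 0 \<Longrightarrow>
       (\<And>z. z \<in> half_plane (1 / real k) \<Longrightarrow> norm (dirichlet_limit lam a z) \<le> M) \<Longrightarrow> Re s \<ge> \<sigma> / 2 \<Longrightarrow>
       norm (psum lam a N s) \<le> C * M"
      using barrelled_imp_partial_sum_bound[OF fr _ bar] by metis
    have "norm (psum lam a N s) \<le> C * M" if s: "Re s > \<sigma> / 2" for N s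
    proof -
      have est: "norm (psum lam (gauss_smooth lam \<epsilon> a) N s) \<le> C * M" if \<epsilon>: "\<epsilon> > 0" for \<epsilon>
      proof (rule bound)
        show "gauss_smooth lam \<epsilon> a \<in> D_inf_plus lam"
          by (rule gauss_smooth_in_D_inf_plus[OF fr w \<epsilon> smooth[OF \<epsilon>]])
        show "norm (dirichlet_limit lam (gauss_smooth lam \<epsilon> a) z) \<le> M" if "z \<in> half_plane (1 / real k)" for z
        proof (rule smooth[OF \<epsilon>])
          have "0 < 1 / real k" using k by simp
          then show "z \<in> half_plane 0" using that unfolding half_plane_def mem_Collect_eq by linarith
        qed
      qed (use M s in auto)
      have "(\<lambda>j. psum lam (gauss_smooth lam (1 / real (Suc j)) a) N s)
        \<longlonglongrightarrow> (\<Sum>n<N. dirichlet_term lam a s n * of_real (exp (- (0 * lam n)\<^sup>2 / 2)))"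
        unfolding psum_def dirichlet_term_gauss_smooth
        by (intro tendsto_intros LIMSEQ_Suc[OF lim_1_over_n]) simp
      then have "(\<lambda>j. norm (psum lam (gauss_smooth lam (1 / real (Suc j)) a) N s)) \<longlonglongrightarrow> norm (psum lam a N s)"
        by (intro tendsto_norm) (simp add: psum_def)
      then show ?thesis using est by (intro LIMSEQ_le_const2) auto
    qed
    from uniformly_convergent_if_psum_bounded[where \<sigma> = "\<sigma> / 2", OF fr this \<open>\<sigma> / 2 > 0\<close>]
    show "uniformly_convergent_on (half_plane \<sigma>) (psum lam a)" by simp
  qed
qed

section \<open>Bohr's theorem implies an inequality for partial sums of Dirichlet polynomials\<close>

lemma near_norming_element:
  fixes h :: "'b \<Rightarrow> complex"
  assumes bd: "\<And>b. b \<in> F \<Longrightarrow> norm (h b) \<le> B" and b0: "b0 \<in> F" "norm (h b0) \<ge> R" and R: "R > 0"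
  obtains b where "b \<in> F" "norm (h b) \<ge> 3 / 4 * R" "\<And>b'. b' \<in> F \<Longrightarrow> norm (h b') \<le> 4 / 3 * norm (h b)"
proof -
  define S where "S = (SUP b\<in>F. norm (h b))"
  have bdd: "bdd_above ((\<lambda>b. norm (h b)) ` F)" using bd by (auto simp: bdd_above_def)
  have up: "norm (h b) \<le> S" if "b \<in> F" for b
    unfolding S_def by (rule cSUP_upper[OF that bdd])
  have "S \<ge> R" using up[OF b0(1)] b0(2) by linarith
  then have "3 / 4 * S < S" using R by simp
  moreover have "F \<noteq> {}" using b0(1) by blast
  ultimately have "\<exists>b\<in>F. 3 / 4 * S < norm (h b)"
    using less_cSUP_iff[of F "\<lambda>b. norm (h b)" "3 / 4 * S"] bdd unfolding S_def by blast
  then obtain b where b: "b \<in> F" "3 / 4 * S < norm (h b)" by blast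
  show ?thesis
  proof (rule that[OF b(1)])
    show "norm (h b) \<ge> 3 / 4 * R" using b(2) \<open>S \<ge> R\<close> by linarith
    show "norm (h b') \<le> 4 / 3 * norm (h b)" if "b' \<in> F" for b' using up[OF that] b(2) by linarith
  qed
qed

text \<open>
  A version of the uniform boundedness principle for the superpositions \<open>\<Sum>k. \<plusminus> b k / 3 ^ k\<close>.  The pairs
  \<open>(i n, b n)\<close> are chosen beforehand, with \<open>t (i n) (b n)\<close> at least \<open>4 ^ n\<close> and nearly as large as \<open>t (i n)\<close> gets
  on \<open>F\<close>.  Only the signs depend on each other: one of \<open>A + B\<close> and \<open>A - B\<close> is at least as large as
  \<open>B\<close>, so the sign at stage \<open>n\<close> can keep the partial sum large, and the tail of the series is too small
  to cancel it.
\<close>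
lemma gliding_hump:
  fixes t :: "'i \<Rightarrow> 'b \<Rightarrow> complex"
  assumes bd: "\<And>i. i \<in> I \<Longrightarrow> \<exists>B. \<forall>b\<in>F. norm (t i b) \<le> B"
    and unbounded: "\<And>R. \<exists>i\<in>I. \<exists>b\<in>F. R \<le> norm (t i b)"
  obtains b :: "nat \<Rightarrow> 'b" and i :: "nat \<Rightarrow> 'i" and e :: "nat \<Rightarrow> real"
    where "\<And>k. b k \<in> F" "\<And>k. i k \<in> I" "\<And>k. \<bar>e k\<bar> = 1"
      "\<And>n. (4 / 3) ^ n / 3 \<le> norm (\<Sum>k. of_real (e k / 3 ^ k) * t (i n) (b k))"
proof -
  have "\<exists>i b. i \<in> I \<and> b \<in> F \<and> 4 ^ n \<le> norm (t i b) \<and> (\<forall>b'\<in>F. norm (t i b') \<le> 4 / 3 * norm (t i b))" for n :: nat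
  proof -
    obtain i b0 where i: "i \<in> I" "b0 \<in> F" "4 / 3 * 4 ^ n \<le> norm (t i b0)" using unbounded by blast
    obtain B where B: "\<And>b. b \<in> F \<Longrightarrow> norm (t i b) \<le> B" using bd[OF i(1)] by blast
    obtain b where "b \<in> F" "norm (t i b) \<ge> 3 / 4 * (4 / 3 * 4 ^ n)" "\<And>b'. b' \<in> F \<Longrightarrow> norm (t i b') \<le> 4 / 3 * norm (t i b)"
      by (rule near_norming_element[of F "t i" B b0 "4 / 3 * 4 ^ n"]) (use B i in auto)
    then show ?thesis using i(1) by auto
  qed
  then obtain i b where I: "\<And>n. i n \<in> I" and F: "\<And>n. b n \<in> F" and big: "\<And>n::nat. 4 ^ n \<le> norm (t (i n) (b n))"
    and norming: "\<And>n b'. b' \<in> F \<Longrightarrow> norm (t (i n) b') \<le> 4 / 3 * norm (t (i n) (b n))"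
    by metis
  let ?u = "\<lambda>n k. t (i n) (b k)"
  define P where "P = (\<lambda>(e::nat \<Rightarrow> real) n r. \<bar>r\<bar> = 1 \<and>
      norm (?u n n) / 3 ^ n \<le> norm ((\<Sum>k<n. of_real (e k / 3 ^ k) * ?u n k) + of_real (r / 3 ^ n) * ?u n n))"
  have "\<exists>e. \<forall>n. P e n (e n)"
  proof (rule dependent_wellorder_choice)
    fix r and f g :: "nat \<Rightarrow> real" and n assume "\<And>m. m < n \<Longrightarrow> f m = g m"
    then have "(\<Sum>k<n. of_real (f k / 3 ^ k) * ?u n k) = (\<Sum>k<n. of_real (g k / 3 ^ k) * ?u n k)"
      by (intro sum.cong) auto
    then show "P f n r = P g n r" by (simp add: P_def)
  next
    fix n and e :: "nat \<Rightarrow> real"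
    let ?A = "\<Sum>k<n. of_real (e k / 3 ^ k) * ?u n k" and ?B = "of_real (1 / 3 ^ n) * ?u n n"
    have "norm ((?A + ?B) - (?A - ?B)) \<le> norm (?A + ?B) + norm (?A - ?B)" by (rule norm_triangle_ineq4)
    moreover have "norm ((?A + ?B) - (?A - ?B)) = 2 * (norm (?u n n) / 3 ^ n)"
    proof -
      have "(?A + ?B) - (?A - ?B) = 2 * ?B" by simp
      then show ?thesis by (simp only: norm_mult norm_numeral norm_of_real) simp
    qed
    ultimately have "norm (?u n n) / 3 ^ n \<le> norm (?A + ?B) \<or> norm (?u n n) / 3 ^ n \<le> norm (?A - ?B)" by linarith
    then have "P e n 1 \<or> P e n (- 1)" by (auto simp: P_def)
    then show "\<exists>r. P e n r" by blast
  qed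
  then obtain e where e: "\<And>n. P e n (e n)" by blast
  have e1: "\<bar>e k\<bar> = 1" for k using e[of k] by (simp add: P_def)
  have main: "(4 / 3) ^ n / 3 \<le> norm (\<Sum>k. of_real (e k / 3 ^ k) * ?u n k)" for n
  proof -
    let ?v = "\<lambda>k. of_real (e k / 3 ^ k) * ?u n k" and ?T = "norm (?u n n)"
    have v: "norm (?v k) \<le> 4 / 3 * ?T * (1 / 3) ^ k" for k
    proof -
      have "norm (?v k) = norm (?u n k) * (1 / 3) ^ k"
        using e1[of k] by (simp add: norm_mult norm_divide norm_power power_divide)
      also have "\<dots> \<le> 4 / 3 * ?T * (1 / 3) ^ k" by (intro mult_right_mono norming F) auto
      finally show ?thesis .
    qed
    have geo: "summable (\<lambda>k. 4 / 3 * ?T * (1 / 3 :: real) ^ k)" by (intro summable_mult summable_geometric) auto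
    have summ: "summable (\<lambda>k. norm (?v k))"
      by (rule summable_comparison_test'[OF geo, of 0]) (use v in simp)
    have "norm (\<Sum>k. ?v (k + Suc n)) \<le> (\<Sum>k. 4 / 3 * ?T * (1 / 3) ^ (k + Suc n))"
    proof (rule norm_suminf_le)
      show "norm (?v (k + Suc n)) \<le> 4 / 3 * ?T * (1 / 3) ^ (k + Suc n)" for k by (rule v)
      show "summable (\<lambda>k. 4 / 3 * ?T * (1 / 3 :: real) ^ (k + Suc n))"
        by (rule summable_ignore_initial_segment[OF geo])
    qed
    also have "\<dots> = 4 / 3 * ?T * (1 / 3) ^ Suc n * (\<Sum>k. (1 / 3) ^ k)"
      by (subst suminf_mult[symmetric]) (auto simp: power_add algebra_simps intro!: summable_geometric)
    also have "(\<Sum>k. (1 / 3 :: real) ^ k) = 3 / 2" by (subst suminf_geometric) auto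
    also have "4 / 3 * ?T * (1 / 3) ^ Suc n * (3 / 2) = 2 / 3 * (?T / 3 ^ n)" by (simp add: power_divide)
    finally have tail: "norm (\<Sum>k. ?v (k + Suc n)) \<le> 2 / 3 * (?T / 3 ^ n)" .
    have "(\<Sum>k. ?v k) = (\<Sum>k. ?v (k + Suc n)) + (\<Sum>k<Suc n. ?v k)"
      by (rule suminf_split_initial_segment[OF summable_norm_cancel[OF summ]])
    moreover have "?T / 3 ^ n \<le> norm (\<Sum>k<Suc n. ?v k)" using e[of n] by (simp add: P_def)
    ultimately have "?T / 3 ^ n - 2 / 3 * (?T / 3 ^ n) \<le> norm (\<Sum>k. ?v k)"
      using tail norm_diff_ineq[of "\<Sum>k<Suc n. ?v k" "\<Sum>k. ?v (k + Suc n)"] by (simp add: add.commute)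
    moreover have "(4 / 3) ^ n \<le> ?T / 3 ^ n" using big[of n] by (simp add: power_divide divide_right_mono)
    ultimately show ?thesis by linarith
  qed
  show ?thesis by (rule that[OF F I e1 main])
qed

lemma psum_polynomial:
  assumes "\<And>n. n \<ge> L \<Longrightarrow> a n = 0" "N \<ge> L"
  shows "psum lam a N s = psum lam a L s"
  unfolding psum_def using assms by (intro sum.mono_neutral_right) (auto simp: dirichlet_term_def)

lemma dirichlet_polynomial_limit:
  assumes "\<And>n. n \<ge> L \<Longrightarrow> a n = 0"
  shows "dirichlet_converges lam a s" "dirichlet_limit lam a s = psum lam a L s"
proof -
  have "(\<lambda>N. psum lam a N s) \<longlonglongrightarrow> psum lam a L s"
    by (intro tendsto_eventually eventually_sequentiallyI[of L] psum_polynomial assms)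
  then show "dirichlet_converges lam a s" "dirichlet_limit lam a s = psum lam a L s"
    by (rule dirichlet_converges_if_psum_tendsto)+
qed

definition unit_polynomials :: "(nat \<Rightarrow> real) \<Rightarrow> (nat \<Rightarrow> complex) set" where
  "unit_polynomials lam = {a. (\<exists>L. \<forall>n\<ge>L. a n = 0) \<and> (\<forall>s\<in>half_plane 0. norm (dirichlet_limit lam a s) \<le> 1)}"

lemma unit_polynomial_converges: "a \<in> unit_polynomials lam \<Longrightarrow> dirichlet_converges lam a s"
  unfolding unit_polynomials_def using dirichlet_polynomial_limit(1) by blast

lemma unit_polynomial_term_le:
  assumes "frequency lam" "a \<in> unit_polynomials lam" "Re s > 0"
  shows "norm (dirichlet_term lam a s n) \<le> 1"
  using assms
  by (intro dirichlet_term_le_vertical_bound[where w = 0] unit_polynomial_converges)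
     (auto simp: unit_polynomials_def half_plane_def)

lemma unit_polynomial_psum_le:
  assumes "frequency lam" "a \<in> unit_polynomials lam" "Re s > 0"
  shows "norm (psum lam a N s) \<le> real N"
proof -
  have "norm (psum lam a N s) \<le> (\<Sum>n<N. 1)"
    unfolding psum_def by (intro sum_norm_le unit_polynomial_term_le assms)
  then show ?thesis by simp
qed

lemma unit_polynomial_scale:
  assumes a: "a \<in> unit_polynomials lam" and c: "cmod c \<le> 1"
  shows "coeff_scale c a \<in> unit_polynomials lam"
proof -
  have "norm (dirichlet_limit lam (coeff_scale c a) s) \<le> 1" if "s \<in> half_plane 0" for s
  proof -
    have "norm (dirichlet_limit lam (coeff_scale c a) s) = cmod c * norm (dirichlet_limit lam a s)"
      using unit_polynomial_converges[OF a] by (simp add: dirichlet_limit_scale norm_mult)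
    also have "\<dots> \<le> 1 * 1" using a c that by (intro mult_mono) (auto simp: unit_polynomials_def)
    finally show ?thesis by simp
  qed
  then show ?thesis using a unfolding unit_polynomials_def coeff_scale_def by auto
qed

text \<open>
  Partial sums of a unit polynomial up to the index \<open>n0\<close> are at most \<open>n0\<close>, because its terms are at
  most one.  If \<open>K\<close> is the supremum of all partial sums on \<open>[Re > \<sigma>]\<close>, blocks beyond \<open>n0\<close> are at most
  \<open>2 K exp (- lam n0)\<close> on \<open>[Re > \<sigma> + 1]\<close>.  With \<open>n0\<close> large and then \<open>K\<close> large in terms of \<open>n0\<close>, the ratio of
  the two suprema exceeds any bound, and rescaling the polynomial gives the claim.
\<close>
lemma polynomial_hump:
  assumes fr: "frequency lam" and \<sigma>: "\<sigma> > 0"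
    and unbounded: "\<And>C. \<exists>a\<in>unit_polynomials lam. \<exists>N s. Re s > \<sigma> \<and> norm (psum lam a N s) > C"
  shows "\<exists>b\<in>unit_polynomials lam. (\<forall>N s. Re s > \<sigma> + 1 \<longrightarrow> norm (psum lam b N s) \<le> 1) \<and>
           (\<exists>N s. Re s > \<sigma> \<and> R \<le> norm (psum lam b N s))"
proof -
  define r where "r = max 1 R"
  have r: "r \<ge> 1" "r \<ge> R" by (auto simp: r_def)
  have "\<forall>\<^sub>F n in sequentially. exp (- (lam n * 1)) < 1 / (8 * r)"
    using r by (intro order_tendstoD(2)[OF frequency_exp_tendsto_0[OF fr]]) auto
  then obtain n0 where n0: "exp (- lam n0) < 1 / (8 * r)"
    unfolding eventually_sequentially by auto
  obtain a N1 s1 where a: "a \<in> unit_polynomials lam" and s1: "Re s1 > \<sigma>"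
    "norm (psum lam a N1 s1) > 4 * r * real n0 + 2 * r"
    using unbounded by blast
  obtain L where L: "\<And>n. n \<ge> L \<Longrightarrow> a n = 0" using a unfolding unit_polynomials_def by blast
  define S where "S = {norm (psum lam a N s) |N s. Re s > \<sigma>}"
  define K where "K = Sup S"
  have "norm (psum lam a N s) \<le> real L" if "Re s > \<sigma>" for N s
  proof (cases "N \<ge> L")
    case True
    then show ?thesis using unit_polynomial_psum_le[OF fr a, of s L] psum_polynomial[OF L True] that \<sigma> by simp
  next
    case False
    then show ?thesis using unit_polynomial_psum_le[OF fr a, of s N] that \<sigma> by simp
  qed
  then have bdd: "bdd_above S" unfolding S_def bdd_above_def by blast
  have K: "norm (psum lam a N s) \<le> K" if "Re s > \<sigma>" for N s
    unfolding K_def using that by (intro cSup_upper[OF _ bdd]) (auto simp: S_def)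
  have K_big: "K > 4 * r * real n0 + 2 * r" using K[OF s1(1), of N1] s1(2) by linarith
  have "K / 2 < K" using K_big r by (smt (verit) field_sum_of_halves mult_nonneg_nonneg of_nat_0_le_iff)
  moreover have "S \<noteq> {}" unfolding S_def using s1(1) by blast
  ultimately have "\<exists>y\<in>S. K / 2 < y" using less_cSup_iff[of S "K / 2"] bdd by (simp add: K_def)
  then obtain N2 s2 where s2: "Re s2 > \<sigma>" "K / 2 < norm (psum lam a N2 s2)" by (auto simp: S_def)
  \<comment> \<open>below, \<open>l\<close> bounds the partial sums on \<open>[Re > \<sigma> + 1]\<close>, while \<open>r * l = K / 2\<close> is exceeded on \<open>[Re > \<sigma>]\<close>\<close>
  define l where "l = K / (2 * r)"
  have l: "l \<ge> 1"
  proof -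
    have "2 * r \<le> K" using K_big r(1) by (smt (verit) mult_nonneg_nonneg of_nat_0_le_iff)
    then show ?thesis using r(1) by (simp add: l_def)
  qed
  have small: "norm (psum lam a N s) \<le> l" if s: "Re s > \<sigma> + 1" for N s
  proof -
    have tail: "norm (\<Sum>n=n0..<N. dirichlet_term lam a s n) \<le> K / (4 * r)"
    proof -
      have "norm (\<Sum>n=n0..<N. dirichlet_term lam a s n) \<le> 2 * K * exp (- (lam n0 * 1))"
        using s by (intro dirichlet_block_decay[OF fr] K) auto
      also have "\<dots> \<le> 2 * K * (1 / (8 * r))"
        using n0 K_big r(1) by (intro mult_left_mono) (auto intro: order.trans[OF _ less_imp_le[OF K_big]])
      finally show ?thesis by simp
    qed
    have n0_le: "real n0 \<le> K / (4 * r)"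
      using K_big r(1) by (simp add: pos_le_divide_eq mult.commute mult.left_commute)
    show ?thesis
    proof (cases "n0 \<le> N")
      case True
      then have "psum lam a N s = psum lam a n0 s + (\<Sum>n=n0..<N. dirichlet_term lam a s n)"
        unfolding psum_def lessThan_atLeast0 by (simp add: sum.atLeastLessThan_concat)
      then have "norm (psum lam a N s) \<le> real n0 + K / (4 * r)"
        using unit_polynomial_psum_le[OF fr a, of s n0] s \<sigma> tail
        by (simp add: norm_triangle_mono)
      then show ?thesis using n0_le by (simp add: l_def field_simps)
    next
      case False
      then have "norm (psum lam a N s) \<le> real n0"
        using unit_polynomial_psum_le[OF fr a, of s N] s \<sigma> by simp
      moreover have "K / (4 * r) \<le> l"
        using l r(1) by (simp add: l_def field_simps)
      ultimately show ?thesis using n0_le by linarith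
    qed
  qed
  define b where "b = coeff_scale (of_real (1 / l)) a"
  have psum_b: "norm (psum lam b N s) = norm (psum lam a N s) / l" for N s
    using l by (simp add: b_def psum_scale norm_mult norm_divide)
  have "b \<in> unit_polynomials lam"
    unfolding b_def using l by (intro unit_polynomial_scale[OF a]) (simp add: norm_divide)
  moreover have "norm (psum lam b N s) \<le> 1" if "Re s > \<sigma> + 1" for N s
    using small[OF that] l by (simp add: psum_b)
  moreover have "R \<le> norm (psum lam b N2 s2)"
  proof -
    have "r * l = K / 2" using r by (simp add: l_def)
    then have "r * l \<le> norm (psum lam a N2 s2)" using s2(2) by linarith
    then have "r \<le> norm (psum lam b N2 s2)" using l by (simp add: psum_b pos_le_divide_eq)
    then show ?thesis using r(2) by linarith
  qed
  ultimately show ?thesis using s2(1) by blast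
qed

text \<open>
  The superposition \<open>d\<close> of the humps converges on \<open>[Re > \<sigma> + 1]\<close> by dominated convergence, since there all
  partial sums of the humps are at most one.  Its limit continues to the uniform sum \<open>g\<close> of the
  polynomials on \<open>[Re > 0]\<close>.  Bohr's theorem makes its partial sums bounded on \<open>[Re > \<sigma>]\<close>, but they are not.
\<close>
lemma bohr_imp_polynomial_bound:
  assumes fr: "frequency lam" and bohr: "bohr_theorem_holds lam" and \<sigma>: "\<sigma> > 0"
  shows "\<exists>C. \<forall>a\<in>unit_polynomials lam. \<forall>N s. Re s > \<sigma> \<longrightarrow> norm (psum lam a N s) \<le> C"
proof (rule ccontr)
  assume "\<not> ?thesis"
  then have unbounded: "\<exists>a\<in>unit_polynomials lam. \<exists>N s. Re s > \<sigma> \<and> norm (psum lam a N s) > C" for C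
    by (meson not_le)
  define F where "F = {b \<in> unit_polynomials lam. \<forall>N s. Re s > \<sigma> + 1 \<longrightarrow> norm (psum lam b N s) \<le> 1}"
  define I where "I = {(N::nat, s). Re s > \<sigma>}"
  define t where "t = (\<lambda>(N, s) b. psum lam b N s)"
  have each: "\<exists>B. \<forall>b\<in>F. norm (t i b) \<le> B" if "i \<in> I" for i
    using that unit_polynomial_psum_le[OF fr] \<sigma> unfolding F_def I_def t_def
    by (intro exI[of _ "real (fst i)"]) auto
  have all: "\<exists>i\<in>I. \<exists>b\<in>F. R \<le> norm (t i b)" for R
  proof -
    obtain b N s where "b \<in> unit_polynomials lam" "\<forall>N s. Re s > \<sigma> + 1 \<longrightarrow> norm (psum lam b N s) \<le> 1"
      "Re s > \<sigma>" "R \<le> norm (psum lam b N s)"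
      using polynomial_hump[OF fr \<sigma> unbounded, of R] by blast
    then show ?thesis unfolding F_def I_def t_def
      by (intro bexI[of _ "(N, s)"] bexI[of _ b]) auto
  qed
  obtain b i e where b: "\<And>k. b k \<in> F" and i: "\<And>k. i k \<in> I" and e: "\<And>k::nat. \<bar>e k\<bar> = (1::real)"
    and hump: "\<And>n. (4 / 3) ^ n / 3 \<le> norm (\<Sum>k. of_real (e k / 3 ^ k) * t (i n) (b k))"
    by (rule gliding_hump[of I F t]) (assumption | rule each all that)+
  have bu: "b k \<in> unit_polynomials lam" for k using b[of k] by (simp add: F_def)
  define c where "c = (\<lambda>k. complex_of_real (e k / 3 ^ k))"
  have c: "norm (c k) = (1 / 3) ^ k" for k
    using e[of k] by (simp add: c_def norm_divide norm_power power_divide)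
  have geo: "summable (\<lambda>k. (1 / 3 :: real) ^ k)" by (intro summable_geometric) auto
  have summ: "summable (\<lambda>k. c k * x k)" if "\<And>k. norm (x k) \<le> B" for x :: "nat \<Rightarrow> complex" and B
  proof (rule summable_comparison_test'[OF summable_mult2[OF geo, of B], of 0])
    show "norm (c k * x k) \<le> (1 / 3) ^ k * B" for k
      unfolding norm_mult c by (intro mult_left_mono that) auto
  qed
  define d where "d = (\<lambda>n. \<Sum>k. c k * b k n)"
  have b_summ: "summable (\<lambda>k. c k * b k n)" for n
  proof (rule summ)
    fix k
    have "norm (dirichlet_term lam (b k) 1 n) \<le> 1"
      by (rule unit_polynomial_term_le[OF fr bu]) simp
    then have "norm (b k n) * exp (- lam n) \<le> 1" by (simp add: dirichlet_term_def norm_mult)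
    then show "norm (b k n) \<le> exp (lam n)" by (simp add: exp_minus field_simps)
  qed
  have psum_d: "psum lam d N s = (\<Sum>k. c k * psum lam (b k) N s)" for N s
  proof -
    have term_summ: "summable (\<lambda>k. c k * dirichlet_term lam (b k) s n)" for n
      using summable_mult2[OF b_summ[of n], of "exp (- (of_real (lam n) * s))"]
      by (simp add: dirichlet_term_def mult.assoc)
    have "psum lam d N s = (\<Sum>n<N. \<Sum>k. c k * dirichlet_term lam (b k) s n)"
      using suminf_mult2[OF b_summ] by (simp add: psum_def dirichlet_term_def d_def mult.assoc)
    also have "\<dots> = (\<Sum>k. \<Sum>n<N. c k * dirichlet_term lam (b k) s n)"
      by (rule suminf_sum[symmetric]) (rule term_summ)
    finally show ?thesis by (simp add: psum_def sum_distrib_left)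
  qed
  define g where "g = (\<lambda>s. \<Sum>k. c k * dirichlet_limit lam (b k) s)"
  have lim_le: "norm (dirichlet_limit lam (b k) s) \<le> 1" if "s \<in> half_plane 0" for k s
    using bu[of k] that by (simp add: unit_polynomials_def)
  have g_unif: "uniform_limit (half_plane 0) (\<lambda>K s. \<Sum>k<K. c k * dirichlet_limit lam (b k) s) g sequentially"
    unfolding g_def
  proof (rule Weierstrass_m_test[OF _ geo])
    fix k s assume "s \<in> half_plane 0"
    then have "(1 / 3) ^ k * norm (dirichlet_limit lam (b k) s) \<le> (1 / 3) ^ k * 1"
      by (intro mult_left_mono lim_le) auto
    then show "norm (c k * dirichlet_limit lam (b k) s) \<le> (1 / 3) ^ k" by (simp add: norm_mult c)
  qed
  have g_hol: "g holomorphic_on half_plane 0"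
  proof (rule holomorphic_uniform_sequence[OF open_half_plane])
    show "(\<lambda>s. \<Sum>k<K. c k * dirichlet_limit lam (b k) s) holomorphic_on half_plane 0" for K
      by (intro holomorphic_intros dirichlet_limit_holomorphic[OF fr] unit_polynomial_converges bu)
    fix x assume "x \<in> half_plane 0"
    then obtain \<rho> where \<rho>: "\<rho> > 0" "cball x \<rho> \<subseteq> half_plane 0"
      using open_half_plane open_contains_cball by blast
    then show "\<exists>\<rho>>0. cball x \<rho> \<subseteq> half_plane 0 \<and>
        uniform_limit (cball x \<rho>) (\<lambda>K s. \<Sum>k<K. c k * dirichlet_limit lam (b k) s) g sequentially"
      using uniform_limit_on_subset[OF g_unif] by blast
  qed
  have g_bd: "bounded (g ` half_plane 0)"
  proof -
    have "norm (g s) \<le> (\<Sum>k. (1 / 3) ^ k)" if s: "s \<in> half_plane 0" for s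
      unfolding g_def
    proof (rule norm_suminf_le[OF _ geo])
      fix k
      have "(1 / 3) ^ k * norm (dirichlet_limit lam (b k) s) \<le> (1 / 3) ^ k * 1"
        by (intro mult_left_mono lim_le s) auto
      then show "norm (c k * dirichlet_limit lam (b k) s) \<le> (1 / 3) ^ k" by (simp add: norm_mult c)
    qed
    then show ?thesis unfolding bounded_iff by blast
  qed
  have d_lim: "(\<lambda>N. psum lam d N s) \<longlonglongrightarrow> g s" if s: "Re s > \<sigma> + 1" for s
    unfolding psum_d g_def
  proof (rule tannerys_theorem[THEN conjunct2, THEN conjunct2])
    show "(\<lambda>N. c k * psum lam (b k) N s) \<longlonglongrightarrow> c k * dirichlet_limit lam (b k) s" for k
      by (intro tendsto_intros psum_tendsto unit_polynomial_converges bu)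
    have "norm (c k * psum lam (b k) N s) \<le> (1 / 3) ^ k" for k N
    proof -
      have "(1 / 3) ^ k * norm (psum lam (b k) N s) \<le> (1 / 3) ^ k * 1"
        using b[of k] s by (intro mult_left_mono) (auto simp: F_def)
      then show ?thesis by (simp add: norm_mult c)
    qed
    then show "\<forall>\<^sub>F (k, N) in at_top \<times>\<^sub>F sequentially. norm (c k * psum lam (b k) N s) \<le> (1 / 3) ^ k"
      by (intro always_eventually) auto
  qed (use geo in auto)
  have "d \<in> D_inf_ext lam"
    unfolding D_inf_ext_def
  proof (intro CollectI conjI exI[of _ g] g_hol g_bd allI impI ballI)
    show "\<exists>s. dirichlet_converges lam d s"
      using dirichlet_converges_if_psum_tendsto(1)[OF d_lim[of "of_real (\<sigma> + 2)"]] by auto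
    fix \<tau> :: real and s assume \<tau>: "\<tau> \<ge> 0" and conv: "\<forall>s\<in>half_plane \<tau>. dirichlet_converges lam d s" and s: "s \<in> half_plane \<tau>"
    show "g s = dirichlet_limit lam d s"
    proof (rule analytic_continuation_open[where s = "half_plane (max \<tau> (\<sigma> + 1))" and s' = "half_plane \<tau>" and f = g])
      show "half_plane (max \<tau> (\<sigma> + 1)) \<noteq> {}" by (rule half_plane_nonempty)
      show "connected (half_plane \<tau>)" by (rule convex_connected[OF convex_half_plane])
      show "g holomorphic_on half_plane \<tau>"
        by (rule holomorphic_on_subset[OF g_hol]) (use \<tau> in \<open>auto simp: half_plane_def\<close>)
      show "dirichlet_limit lam d holomorphic_on half_plane \<tau>"
        using conv by (intro dirichlet_limit_holomorphic[OF fr]) auto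
      show "g z = dirichlet_limit lam d z" if "z \<in> half_plane (max \<tau> (\<sigma> + 1))" for z
        using dirichlet_converges_if_psum_tendsto(2)[OF d_lim[of z]] that by (simp add: half_plane_def)
      show "half_plane (max \<tau> (\<sigma> + 1)) \<subseteq> half_plane \<tau>" by (auto simp: half_plane_def)
    qed (use s open_half_plane in auto)
  qed
  then have "sigma_u lam d < ereal \<sigma>"
    using bohr \<sigma> unfolding bohr_theorem_holds_def by (metis ereal_less(2) order.strict_trans1)
  then obtain \<rho> where \<rho>: "\<rho> < \<sigma>" "uniformly_convergent_on (half_plane \<rho>) (psum lam d)"
    unfolding sigma_u_def Inf_less_iff by (auto simp: psum_def[abs_def])
  then have "uniformly_Cauchy_on (half_plane \<rho>) (psum lam d)"
    using uniformly_convergent_Cauchy by blast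
  then obtain N0 where N0: "\<And>s m n. s \<in> half_plane \<rho> \<Longrightarrow> m \<ge> N0 \<Longrightarrow> n \<ge> N0 \<Longrightarrow> dist (psum lam d m s) (psum lam d n s) < 1"
    unfolding uniformly_Cauchy_on_def by (metis zero_less_one)
  define B where "B = (\<Sum>n<N0. norm (d n))"
  have init: "norm (psum lam d N s) \<le> B" if "N \<le> N0" "Re s > \<sigma>" for N s
  proof -
    have "norm (dirichlet_term lam d s n) \<le> norm (d n)" for n
      using that(2) \<sigma> frequency_nonneg[OF fr, of n] by (simp add: dirichlet_term_def norm_mult mult_left_le)
    then have "norm (psum lam d N s) \<le> (\<Sum>n<N. norm (d n))"
      unfolding psum_def by (rule sum_norm_le)
    also have "\<dots> \<le> B" unfolding B_def using that(1) by (intro sum_mono2) auto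
    finally show ?thesis .
  qed
  have bound: "norm (psum lam d N s) \<le> B + 1" if s: "Re s > \<sigma>" for N s
  proof (cases "N \<le> N0")
    case False
    have "norm (psum lam d N s - psum lam d N0 s) < 1"
      using N0[of s N N0] False s \<rho>(1) by (simp add: half_plane_def dist_norm)
    then show ?thesis using init[of N0 s] s norm_triangle_sub[of "psum lam d N s" "psum lam d N0 s"] by simp
  qed (use init[OF _ s] in fastforce)
  obtain n where n: "3 * (B + 1) < (4 / 3 :: real) ^ n" using real_arch_pow[of "4 / 3"] by auto
  obtain N s where Ns: "i n = (N, s)" "Re s > \<sigma>" using i[of n] by (auto simp: I_def)
  have "(4 / 3) ^ n / 3 \<le> norm (psum lam d N s)"
    using hump[of n] by (simp add: Ns(1) t_def psum_d c_def)
  then show False using bound[OF Ns(2), of N] n by simp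
qed

section \<open>Bohr's theorem implies completeness\<close>

text \<open>
  A series in \<open>D_inf_plus\<close>, shifted by \<open>1 / k\<close>, is bounded on \<open>[Re > 0]\<close> and so converges uniformly on every
  smaller half-plane by Bohr's theorem.  After a further small shift it is a uniform limit of
  polynomials on \<open>[Re > 0]\<close>, to which the bound for polynomials applies.
\<close>
lemma bohr_imp_partial_sum_bound:
  assumes fr: "frequency lam" and bohr: "bohr_theorem_holds lam" and k: "k \<ge> 1" and \<sigma>: "1 / real k < \<sigma>"
  obtains C where "C \<ge> 0"
    "\<And>a N s. a \<in> D_inf_plus lam \<Longrightarrow> Re s > \<sigma> \<Longrightarrow> norm (psum lam a N s) \<le> C * dirichlet_norm lam k a"
proof -
  define \<tau> where "\<tau> = 1 / real k"
  \<comment> \<open>one \<open>\<eta>\<close> is spent on uniform convergence, the other one on the bound for polynomials\<close>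
  define \<eta> where "\<eta> = (\<sigma> - \<tau>) / 2"
  have \<tau>: "\<tau> > 0" using k by (simp add: \<tau>_def)
  have \<eta>: "\<eta> > 0" "\<sigma> = \<tau> + \<eta> + \<eta>" using \<sigma> by (auto simp: \<eta>_def \<tau>_def field_simps)
  obtain C0 where C0: "\<And>a N s. a \<in> unit_polynomials lam \<Longrightarrow> Re s > \<eta> \<Longrightarrow> norm (psum lam a N s) \<le> C0"
    using bohr_imp_polynomial_bound[OF fr bohr \<eta>(1)] by blast
  define C where "C = max 0 C0"
  have C: "norm (psum lam a N s) \<le> C" if "a \<in> unit_polynomials lam" "Re s > \<eta>" for a N s
    using C0[OF that, of N] by (simp add: C_def)
  have "C \<ge> 0" by (simp add: C_def)
  moreover have "norm (psum lam a N s) \<le> C * dirichlet_norm lam k a" if a: "a \<in> D_inf_plus lam" and s: "Re s > \<sigma>" for a N s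
  proof -
    let ?M = "dirichlet_norm lam k a"
    have M: "?M \<ge> 0" using seminorm_on_dirichlet_norm[OF k] a unfolding seminorm_on_def by blast
    define a' where "a' = dirichlet_shift lam (of_real \<tau>) a"
    have a'_bound: "norm (dirichlet_limit lam a' z) \<le> ?M" if "z \<in> half_plane 0" for z
      unfolding a'_def dirichlet_limit_shift
      using that by (intro dirichlet_limit_le_norm a k) (simp add: half_plane_def \<tau>_def)
    have a': "a' \<in> D_inf_plus lam" unfolding a'_def using \<tau> by (intro D_inf_plus_shift a) simp
    have conv: "dirichlet_converges lam a' z" if "z \<in> half_plane 0" for z
      using D_inf_plus_converges[OF a' order.refl that] .
    have "a' \<in> D_inf_ext lam"
      unfolding D_inf_ext_def
    proof (intro CollectI conjI exI[of _ "dirichlet_limit lam a'"] exI[of _ 1])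
      show "dirichlet_converges lam a' 1" by (rule conv) (simp add: half_plane_def)
      show "dirichlet_limit lam a' holomorphic_on half_plane 0" by (rule dirichlet_limit_holomorphic[OF fr conv])
      show "bounded (dirichlet_limit lam a' ` half_plane 0)" using a'_bound unfolding bounded_iff by blast
    qed auto
    then have "sigma_u lam a' < ereal \<eta>"
      using bohr \<eta>(1) unfolding bohr_theorem_holds_def by (metis ereal_less(2) order.strict_trans1)
    then obtain \<rho> where \<rho>: "\<rho> < \<eta>" "uniformly_convergent_on (half_plane \<rho>) (psum lam a')"
      unfolding sigma_u_def Inf_less_iff by (auto simp: psum_def[abs_def])
    then obtain l where l: "uniform_limit (half_plane \<rho>) (psum lam a') l sequentially"
      unfolding uniformly_convergent_on_def by blast
    have l_eq: "l z = dirichlet_limit lam a' z" if "z \<in> half_plane \<rho>" for z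
      using dirichlet_converges_if_psum_tendsto(2)[OF tendsto_uniform_limitI[OF l that]] by simp
    have est: "norm (psum lam a N s) \<le> C * (?M + e)" if e: "e > 0" for e
    proof -
      have "\<forall>\<^sub>F L in sequentially. N \<le> L \<and> (\<forall>z\<in>half_plane \<rho>. dist (psum lam a' L z) (l z) < e)"
        by (intro eventually_conj eventually_ge_at_top uniform_limitD[OF l e])
      then obtain L where L: "N \<le> L" "\<And>z. z \<in> half_plane \<rho> \<Longrightarrow> dist (psum lam a' L z) (l z) < e"
        unfolding eventually_sequentially by blast
      define p where "p = (\<lambda>n. if n < L then dirichlet_shift lam (of_real (\<tau> + \<eta>)) a n else 0)"
      have psum_p: "psum lam p n z = psum lam a n (z + of_real (\<tau> + \<eta>))" if "n \<le> L" for n z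
      proof -
        have "psum lam p n z = psum lam (dirichlet_shift lam (of_real (\<tau> + \<eta>)) a) n z"
          unfolding psum_def using that by (intro sum.cong) (auto simp: p_def dirichlet_term_def)
        then show ?thesis by (simp only: psum_shift)
      qed
      have p_lim: "dirichlet_converges lam p z" "dirichlet_limit lam p z = psum lam a L (z + of_real (\<tau> + \<eta>))" for z
        using dirichlet_polynomial_limit[of L p lam z] psum_p[of L z] by (auto simp: p_def)
      have p_bound: "norm (dirichlet_limit lam p z) \<le> ?M + e" if z: "z \<in> half_plane 0" for z
      proof -
        have zr: "z + of_real \<eta> \<in> half_plane \<rho>" "z + of_real \<eta> \<in> half_plane 0"
          using z \<rho>(1) \<eta>(1) by (auto simp: half_plane_def)
        have "dirichlet_limit lam p z = psum lam a' L (z + of_real \<eta>)"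
          by (simp add: p_lim(2) a'_def psum_shift algebra_simps)
        moreover have "norm (psum lam a' L (z + of_real \<eta>) - dirichlet_limit lam a' (z + of_real \<eta>)) < e"
          using L(2)[OF zr(1)] l_eq[OF zr(1)] by (simp add: dist_norm)
        ultimately show ?thesis
          using a'_bound[OF zr(2)] norm_triangle_sub[of "psum lam a' L (z + of_real \<eta>)" "dirichlet_limit lam a' (z + of_real \<eta>)"]
          by simp
      qed
      let ?q = "coeff_scale (of_real (1 / (?M + e))) p"
      have "?q \<in> unit_polynomials lam"
        unfolding unit_polynomials_def
      proof (intro CollectI conjI ballI)
        show "\<exists>L. \<forall>n\<ge>L. ?q n = 0" by (rule exI[of _ L]) (simp add: coeff_scale_def p_def)
        show "norm (dirichlet_limit lam ?q z) \<le> 1" if "z \<in> half_plane 0" for z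
          unfolding dirichlet_limit_scale[OF p_lim(1)] norm_mult norm_of_real
          using p_bound[OF that] M e by simp
      qed
      then have "norm (psum lam ?q N (s - of_real (\<tau> + \<eta>))) \<le> C"
        using s \<eta> by (intro C) auto
      then have "norm (complex_of_real (1 / (?M + e))) * norm (psum lam a N s) \<le> C"
        by (simp only: psum_scale psum_p[OF L(1)] norm_mult diff_add_cancel)
      then have "norm (psum lam a N s) / (?M + e) \<le> C"
        using M e unfolding norm_of_real by simp
      then show ?thesis using M e by (simp add: pos_divide_le_eq)
    qed
    show ?thesis
    proof (rule field_le_epsilon)
      fix e :: real assume e: "e > 0"
      have "C * (?M + e / (C + 1)) = C * ?M + C / (C + 1) * e" by (simp add: algebra_simps)
      moreover have "C / (C + 1) * e \<le> 1 * e" using \<open>C \<ge> 0\<close> e by (intro mult_right_mono) auto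
      moreover have "e / (C + 1) > 0" using \<open>C \<ge> 0\<close> e by simp
      ultimately show "norm (psum lam a N s) \<le> C * ?M + e" using est[of "e / (C + 1)"] by linarith
    qed
  qed
  ultimately show ?thesis using that by blast
qed

text \<open>
  The first seminorm is already a norm, because it controls every coefficient.
\<close>
lemma Hausdorff_D_inf_plus:
  assumes fr: "frequency lam"
  shows "Hausdorff_space (D_inf_plus_topology lam)"
  unfolding Hausdorff_space_def
proof (intro allI impI, elim conjE)
  fix x y assume "x \<in> topspace (D_inf_plus_topology lam)" "y \<in> topspace (D_inf_plus_topology lam)" and neq: "x \<noteq> y"
  then have x: "x \<in> D_inf_plus lam" and y: "y \<in> D_inf_plus lam" by (auto simp: D_inf_plus_topology_def)
  let ?p = "dirichlet_norm lam 1"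
  have p: "seminorm_on coeff_scale (D_inf_plus lam) ?p" by (rule seminorm_on_dirichlet_norm) simp
  note tri = seminorm_triangle[OF vector_space_coeff_scale subspace_D_inf_plus p]
  note comm = seminorm_diff_commute[OF vector_space_coeff_scale subspace_D_inf_plus p]
  obtain n where "x n \<noteq> y n" using neq by blast
  then have "0 < norm (dirichlet_term lam (x - y) 2 n)" by (simp add: dirichlet_term_def)
  also have "\<dots> \<le> ?p (x - y)" by (intro dirichlet_term_le_norm fr D_inf_plus_diff x y) auto
  finally have pos: "0 < ?p (x - y)" .
  let ?U = "\<lambda>z. {u \<in> D_inf_plus lam. ?p (u - z) < ?p (x - y) / 2}"
  have "disjnt (?U x) (?U y)"
    unfolding disjnt_iff
  proof (intro allI notI, elim conjE)
    fix u assume u: "u \<in> ?U x" "u \<in> ?U y"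
    then have "?p (x - y) \<le> ?p (x - u) + ?p (u - y)" by (intro tri x y) auto
    then show False using u comm[OF x, of u] by simp
  qed
  moreover have "openin (D_inf_plus_topology lam) (?U x)" "openin (D_inf_plus_topology lam) (?U y)"
    by (intro openin_dirichlet_norm_ball order.refl x y)+
  moreover have "x \<in> ?U x" "y \<in> ?U y"
  proof -
    have "?p 0 = 0"
      using p D.subspace_0[OF subspace_D_inf_plus] unfolding seminorm_on_def
      by (metis D.scale_zero_right mult_eq_0_iff norm_eq_zero D.scale_zero_left)
    then show "x \<in> ?U x" "y \<in> ?U y" using x y pos by auto
  qed
  ultimately show "\<exists>U V. openin (D_inf_plus_topology lam) U \<and> openin (D_inf_plus_topology lam) V \<and> x \<in> U \<and> y \<in> V \<and> disjnt U V"
    by blast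
qed

text \<open>
  A Cauchy sequence converges coefficientwise; the bound makes its partial sums converge uniformly
  in \<open>N\<close> and \<open>s\<close>, so the limiting coefficients define a convergent series and the limit in \<open>N\<close> can be taken
  inside the estimate.  The sets \<open>S m\<close> of small diameter carry the estimate from the chosen sequence \<open>x\<close>
  over to the filter.
\<close>
lemma complete_if_partial_sum_bound:
  assumes fr: "frequency lam"
    and bound: "\<And>k \<sigma>. k \<ge> 1 \<Longrightarrow> 1 / real k < \<sigma> \<Longrightarrow> \<exists>C\<ge>0. \<forall>a\<in>D_inf_plus lam. \<forall>N s. Re s > \<sigma> \<longrightarrow>
                  norm (psum lam a N s) \<le> C * dirichlet_norm lam k a"
  shows "complete_tvs (D_inf_plus lam) (D_inf_plus_topology lam)"
  unfolding complete_tvs_def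
proof (intro allI impI)
  fix F assume F: "cauchy_filter_in (D_inf_plus lam) (D_inf_plus_topology lam) F"
  let ?X = "D_inf_plus lam"
  have "\<exists>S. (\<forall>\<^sub>F y in F. y \<in> S) \<and> S \<subseteq> ?X \<and> (\<forall>y\<in>S. \<forall>z\<in>S. dirichlet_norm lam (Suc k) (y - z) < 1 / real (Suc k))" for k
  proof -
    let ?U = "{y \<in> ?X. dirichlet_norm lam (Suc k) (y - 0) < 1 / real (Suc k)}"
    have z: "0 \<in> ?X" by (rule D.subspace_0[OF subspace_D_inf_plus])
    have "dirichlet_norm lam (Suc k) 0 = 0"
      using seminorm_on_dirichlet_norm[of "Suc k" lam] z unfolding seminorm_on_def
      by (metis D.scale_zero_left mult_eq_0_iff norm_zero le_add1 plus_1_eq_Suc)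
    then have "0 \<in> ?U" using z by simp
    moreover have "openin (D_inf_plus_topology lam) ?U" by (rule openin_dirichlet_norm_ball) (use z in auto)
    ultimately obtain S where S: "\<forall>\<^sub>F y in F. y \<in> S" "\<forall>y\<in>S. \<forall>z\<in>S. y - z \<in> ?U"
      using F unfolding cauchy_filter_in_def by meson
    have "\<forall>\<^sub>F y in F. y \<in> ?X" using F unfolding cauchy_filter_in_def by blast
    with S(1) have "\<forall>\<^sub>F y in F. y \<in> S \<inter> ?X" unfolding Int_iff by (rule eventually_conj)
    then show ?thesis using S(2) by (intro exI[of _ "S \<inter> ?X"]) simp
  qed
  then obtain S where S_ev: "\<And>k. \<forall>\<^sub>F y in F. y \<in> S k" and SX: "\<And>k. S k \<subseteq> ?X"
    and S: "\<And>k y z. y \<in> S k \<Longrightarrow> z \<in> S k \<Longrightarrow> dirichlet_norm lam (Suc k) (y - z) < 1 / real (Suc k)"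
    by metis
  have "\<exists>x. \<forall>j\<in>{..k}. x \<in> S j" for k :: nat
  proof -
    have "\<forall>\<^sub>F y in F. \<forall>j\<in>{..k}. y \<in> S j" by (intro eventually_ball_finite) (auto intro: S_ev)
    moreover have "F \<noteq> bot" using F unfolding cauchy_filter_in_def by blast
    ultimately show ?thesis using eventually_happens' by blast
  qed
  then obtain x where x: "\<And>j k. j \<le> k \<Longrightarrow> x k \<in> S j" by (metis atMost_iff)
  have xX: "x k \<in> ?X" for k using x[of k k] SX by auto
  have small: "\<exists>m\<ge>m0. C / real (Suc m) < e" if "e > 0" for C e :: real and m0
  proof -
    have "(\<lambda>m. C * (1 / real (Suc m))) \<longlonglongrightarrow> C * 0" by (intro tendsto_intros LIMSEQ_Suc[OF lim_1_over_n])
    then have "\<forall>\<^sub>F m in sequentially. C * (1 / real (Suc m)) < e" using that by (intro order_tendstoD(2)[where a = e]) auto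
    then have "\<forall>\<^sub>F m in sequentially. m0 \<le> m \<and> C * (1 / real (Suc m)) < e"
      by (intro eventually_conj eventually_ge_at_top)
    then show ?thesis unfolding eventually_sequentially by auto
  qed
  have "Cauchy (\<lambda>k. x k n)" for n
  proof (rule metric_CauchyI)
    fix e :: real assume "e > 0"
    then obtain m where m: "m \<ge> 1" "exp (lam n) / real (Suc m) < e" using small by blast
    have "dist (x i n) (x j n) < e" if "i \<ge> m" "j \<ge> m" for i j
    proof -
      have xS: "x i \<in> S m" "x j \<in> S m" using x that by auto
      have "norm (dirichlet_term lam (x i - x j) 1 n) \<le> dirichlet_norm lam (Suc m) (x i - x j)"
        using m(1) by (intro dirichlet_term_le_norm fr D_inf_plus_diff xX) auto
      also have "\<dots> < 1 / real (Suc m)" by (rule S[OF xS])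
      finally have "norm (x i n - x j n) * exp (- lam n) < 1 / real (Suc m)"
        by (simp add: dirichlet_term_def norm_mult)
      then have "norm (x i n - x j n) < exp (lam n) / real (Suc m)"
        by (simp add: exp_minus field_simps)
      then show ?thesis using m(2) by (simp add: dist_norm)
    qed
    then show "\<exists>M. \<forall>i\<ge>M. \<forall>j\<ge>M. dist (x i n) (x j n) < e" by blast
  qed
  then have "\<exists>l. (\<lambda>k. x k n) \<longlonglongrightarrow> l" for n using Cauchy_convergent unfolding convergent_def by blast
  then obtain a where a: "\<And>n. (\<lambda>k. x k n) \<longlonglongrightarrow> a n" by metis
  have psum_lim: "(\<lambda>k. psum lam (x k) N s) \<longlonglongrightarrow> psum lam a N s" for N s
    unfolding psum_def dirichlet_term_def by (intro tendsto_intros a)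
  have key: "\<exists>C m0. \<forall>m\<ge>m0. \<forall>y\<in>S m. \<forall>N s. Re s > \<sigma> \<longrightarrow> norm (psum lam y N s - psum lam a N s) \<le> C / real (Suc m)"
    if \<sigma>: "\<sigma> > 0" for \<sigma>
  proof -
    obtain m0 where m0: "1 / real (Suc m0) < \<sigma>" using small[OF \<sigma>] by blast
    obtain C where C: "C \<ge> 0" "\<And>a N s. a \<in> ?X \<Longrightarrow> Re s > \<sigma> \<Longrightarrow> norm (psum lam a N s) \<le> C * dirichlet_norm lam (Suc m0) a"
      using bound[of "Suc m0" \<sigma>] m0 by auto
    have "norm (psum lam y N s - psum lam a N s) \<le> C / real (Suc m)" if m: "m \<ge> m0" and y: "y \<in> S m" and s: "Re s > \<sigma>" for m y N s
    proof -
      have "norm (psum lam y N s - psum lam (x j) N s) \<le> C / real (Suc m)" if j: "j \<ge> m" for j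
      proof -
        have xj: "x j \<in> S m" using x j by blast
        have yx: "y - x j \<in> ?X" using y xj SX D_inf_plus_diff by blast
        have "norm (psum lam (y - x j) N s) \<le> C * dirichlet_norm lam (Suc m0) (y - x j)" by (rule C(2)[OF yx s])
        also have "\<dots> \<le> C * dirichlet_norm lam (Suc m) (y - x j)"
          using m by (intro mult_left_mono C(1) dirichlet_norm_mono yx) auto
        also have "\<dots> \<le> C * (1 / real (Suc m))"
          using S[OF y xj] by (intro mult_left_mono C(1)) simp
        finally show ?thesis by (simp add: psum_diff)
      qed
      moreover have "(\<lambda>j. norm (psum lam y N s - psum lam (x j) N s)) \<longlonglongrightarrow> norm (psum lam y N s - psum lam a N s)"
        by (intro tendsto_intros psum_lim)
      ultimately show ?thesis by (intro LIMSEQ_le_const2) blast+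
    qed
    then show ?thesis by blast
  qed
  have conv: "dirichlet_converges lam a s" if s: "s \<in> half_plane 0" for s
  proof -
    have s': "Re s / 2 > 0" "Re s > Re s / 2" using s by (auto simp: half_plane_def)
    obtain C m0 where C: "\<And>m y N. m \<ge> m0 \<Longrightarrow> y \<in> S m \<Longrightarrow> norm (psum lam y N s - psum lam a N s) \<le> C / real (Suc m)"
      using key[OF s'(1)] s'(2) by blast
    have "Cauchy (\<lambda>N. psum lam a N s)"
    proof (rule metric_CauchyI)
      fix e :: real assume "e > 0"
      then have "e / 3 > 0" by simp
      then obtain m where m: "m \<ge> m0" "C / real (Suc m) < e / 3" using small by blast
      have near: "norm (psum lam (x m) N s - psum lam a N s) < e / 3" for N
        using C[OF m(1) x[OF order.refl], of N] m(2) by linarith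
      have "Cauchy (\<lambda>N. psum lam (x m) N s)"
        using psum_tendsto[OF D_inf_plus_converges[OF xX order.refl s]] by (rule LIMSEQ_imp_Cauchy)
      then obtain N0 where N0: "\<And>i j. i \<ge> N0 \<Longrightarrow> j \<ge> N0 \<Longrightarrow> dist (psum lam (x m) i s) (psum lam (x m) j s) < e / 3"
        using \<open>e / 3 > 0\<close> unfolding Cauchy_def by blast
      have "dist (psum lam a i s) (psum lam a j s) < e" if "i \<ge> N0" "j \<ge> N0" for i j
        using N0[OF that] near[of i] near[of j] dist_triangle[of "psum lam a i s" "psum lam a j s" "psum lam (x m) i s"]
          dist_triangle[of "psum lam (x m) i s" "psum lam a j s" "psum lam (x m) j s"]
        by (simp add: dist_norm norm_minus_commute)
      then show "\<exists>M. \<forall>i\<ge>M. \<forall>j\<ge>M. dist (psum lam a i s) (psum lam a j s) < e" by blast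
    qed
    then obtain l where "(\<lambda>N. psum lam a N s) \<longlonglongrightarrow> l" using Cauchy_convergent unfolding convergent_def by blast
    then show ?thesis by (rule dirichlet_converges_if_psum_tendsto(1))
  qed
  have limit: "\<exists>C m0. \<forall>m\<ge>m0. \<forall>y\<in>S m. \<forall>s\<in>half_plane \<sigma>. norm (dirichlet_limit lam y s - dirichlet_limit lam a s) \<le> C / real (Suc m)"
    if \<sigma>: "\<sigma> > 0" for \<sigma>
  proof -
    obtain C m0 where C: "\<And>m y N s. m \<ge> m0 \<Longrightarrow> y \<in> S m \<Longrightarrow> Re s > \<sigma> \<Longrightarrow> norm (psum lam y N s - psum lam a N s) \<le> C / real (Suc m)"
      using key[OF \<sigma>] by blast
    have "norm (dirichlet_limit lam y s - dirichlet_limit lam a s) \<le> C / real (Suc m)" if "m \<ge> m0" "y \<in> S m" "s \<in> half_plane \<sigma>" for m y s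
    proof (rule LIMSEQ_le_const2)
      have "s \<in> half_plane 0" "y \<in> ?X" using that \<sigma> SX by (auto simp: half_plane_def)
      then show "(\<lambda>N. norm (psum lam y N s - psum lam a N s)) \<longlonglongrightarrow> norm (dirichlet_limit lam y s - dirichlet_limit lam a s)"
        by (intro tendsto_intros psum_tendsto conv D_inf_plus_converges[of y lam 0]) auto
      show "\<exists>N. \<forall>n\<ge>N. norm (psum lam y n s - psum lam a n s) \<le> C / real (Suc m)"
        using C[OF that(1,2)] that(3) by (auto simp: half_plane_def)
    qed
    then show ?thesis by blast
  qed
  have aX: "a \<in> ?X"
    unfolding D_inf_plus_def
  proof (intro CollectI conjI ballI allI impI conv)
    fix \<sigma> :: real assume \<sigma>: "\<sigma> > 0"
    obtain C m where C: "\<And>y s. y \<in> S m \<Longrightarrow> s \<in> half_plane \<sigma> \<Longrightarrow> norm (dirichlet_limit lam y s - dirichlet_limit lam a s) \<le> C / real (Suc m)"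
      using limit[OF \<sigma>] by blast
    have "bounded (dirichlet_limit lam (x m) ` half_plane \<sigma>)" using xX[of m] \<sigma> by (simp add: D_inf_plus_def)
    then obtain M where M: "\<And>s. s \<in> half_plane \<sigma> \<Longrightarrow> norm (dirichlet_limit lam (x m) s) \<le> M"
      unfolding bounded_iff by blast
    have "norm (dirichlet_limit lam a s) \<le> M + C / real (Suc m)" if "s \<in> half_plane \<sigma>" for s
      using M[OF that] C[OF x[OF order.refl] that] norm_triangle_sub[of "dirichlet_limit lam a s" "dirichlet_limit lam (x m) s"]
      by (simp add: norm_minus_commute)
    then show "bounded (dirichlet_limit lam a ` half_plane \<sigma>)" unfolding bounded_iff by blast
  qed
  have "limitin (D_inf_plus_topology lam) (\<lambda>y. y) a F"
    unfolding limitin_def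
  proof (intro conjI allI impI)
    show "a \<in> topspace (D_inf_plus_topology lam)" using aX by (simp add: D_inf_plus_topology_def)
    fix U assume "openin (D_inf_plus_topology lam) U \<and> a \<in> U"
    then have U: "openin (D_inf_plus_topology lam) U" "a \<in> U" by blast+
    obtain k e where k: "k \<ge> 1" "e > 0" and nb: "\<And>y. y \<in> ?X \<Longrightarrow> dirichlet_norm lam k (y - a) < e \<Longrightarrow> y \<in> U"
      using D_inf_plus_neighbourhood[OF U] by blast
    have "1 / real k > 0" using k by simp
    then obtain C m0 where C: "\<And>m y s. m \<ge> m0 \<Longrightarrow> y \<in> S m \<Longrightarrow> s \<in> half_plane (1 / real k) \<Longrightarrow>
        norm (dirichlet_limit lam y s - dirichlet_limit lam a s) \<le> C / real (Suc m)"
      using limit by meson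
    obtain m where m: "m \<ge> m0" "C / real (Suc m) < e" using small[OF k(2)] by blast
    have "y \<in> U" if y: "y \<in> S m" for y
    proof (rule nb)
      show yX: "y \<in> ?X" using y SX by blast
      have "dirichlet_norm lam k (y - a) \<le> C / real (Suc m)"
      proof (rule dirichlet_norm_le)
        fix s assume s: "s \<in> half_plane (1 / real k)"
        have "s \<in> half_plane 0" using s \<open>1 / real k > 0\<close> unfolding half_plane_def mem_Collect_eq by linarith
        then have "(\<lambda>N. psum lam (y - a) N s) \<longlonglongrightarrow> dirichlet_limit lam y s - dirichlet_limit lam a s"
          unfolding psum_diff by (intro tendsto_intros psum_tendsto conv D_inf_plus_converges[OF yX order.refl])
        then show "norm (dirichlet_limit lam (y - a) s) \<le> C / real (Suc m)"
          using C[OF m(1) y s] by (simp add: dirichlet_converges_if_psum_tendsto(2))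
      qed
      then show "dirichlet_norm lam k (y - a) < e" using m(2) by linarith
    qed
    then show "\<forall>\<^sub>F y in F. y \<in> U" using S_ev[of m] by (auto elim: eventually_mono)
  qed
  then show "\<exists>a\<in>?X. limitin (D_inf_plus_topology lam) (\<lambda>y. y) a F" using aX by blast
qed

lemma bohr_imp_frechet:
  assumes fr: "frequency lam" and bohr: "bohr_theorem_holds lam"
  shows "frechet_space coeff_scale (D_inf_plus lam) (D_inf_plus_topology lam)"
  unfolding frechet_space_def pre_frechet_space_def
proof (intro conjI)
  show "locally_convex_space coeff_scale (D_inf_plus lam) (D_inf_plus_topology lam)"
    by (rule locally_convex_space_D_inf_plus)
  show "Hausdorff_space (D_inf_plus_topology lam)" by (rule Hausdorff_D_inf_plus[OF fr])
  show "\<exists>P. countable P \<and> (\<forall>p\<in>P. seminorm_on coeff_scale (D_inf_plus lam) p) \<and> D_inf_plus_topology lam = seminorm_topology (D_inf_plus lam) P"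
    using seminorm_on_dirichlet_norm
    by (intro exI[of _ "dirichlet_norm lam ` {1..}"]) (auto simp: D_inf_plus_topology_def)
  show "complete_tvs (D_inf_plus lam) (D_inf_plus_topology lam)"
    by (rule complete_if_partial_sum_bound[OF fr]) (metis bohr_imp_partial_sum_bound[OF fr bohr])
qed

section \<open>The equivalence\<close>

theorem theorem5p2:
  fixes lam :: "nat \<Rightarrow> real"
  assumes "frequency lam"
  shows "(bohr_theorem_holds lam \<longleftrightarrow>
            frechet_space coeff_scale (D_inf_plus lam) (D_inf_plus_topology lam)) \<and>
         (frechet_space coeff_scale (D_inf_plus lam) (D_inf_plus_topology lam) \<longleftrightarrow>
            barrelled_space coeff_scale (D_inf_plus lam) (D_inf_plus_topology lam))"
  using bohr_imp_frechet[OF assms] frechet_imp_barrelled barrelled_imp_bohr[OF assms] by blast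

end
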